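(* Let $0\le t_1<\dots<t_n$ and let $u:\mathbb{R}^{d\times n}\to\mathbb{R}$ be (Borel measurable and) locally bounded, and suppose there exists $p\ge0$ such that $u(x_1,\dots,x_n)\stackrel{\infty}{=}O(\max_{1\le i\le n}|x_i|^p)$. If $p>0$, suppose additionally that $$\int_0^{+\infty}\int_1^{+\infty}s^{2p-1}\,\mathbb{P}^{(x,0)}(|M_w|>s)\,ds\,\mu_t(dw)<+\infty,\qquad t\in\{t_1,\dots,t_n\},\tag{a}$$ for some $x\in\mathbb{R}^d$. For all such $x$ let $$S_N=\frac{\sqrt{N}\,\big(q_N(t_1,\dots,t_n)-q(t_1,\dots,t_n,x)\big)}{\sigma(t_1,\dots,t_n,x)},$$ where $\sigma(t_1,\dots,t_n,x)^2=\mathbb{E}^{(x,0)}\big[u(M_{T_{t_1}},\dots,M_{T_{t_n}})-q(t_1,\dots,t_n,x)\big]^2$ (understood to be nonzero, so that $S_N$ is defined). Then for every $\psi\in C_b(\mathbb{R})$, $$\mathbb{E}^{(x,0)}[\psi(S_N)]\to\int_{\mathbb{R}}\psi(w)\frac{e^{-w^2/2}}{\sqrt{2\pi}}\,dw,\qquad N\to+\infty.$$ If, furthermore, (a) is replaced by the condition $$\int_0^{+\infty}\int_1^{+\infty}s^{3p-1}\,\mathbb{P}^{(x,0)}(|M_w|>s)\,ds\,\mu_t(dw)<+\infty,\qquad t\in\{t_1,\dots,t_n\},$$ for some $x\in\mathbb{R}^d$, then for all such $x$ and all $\psi\in C_b^3(\mathbb{R})$, $$\left|\mathbb{E}^{(x,0)}\psi(S_N)-\int_{\mathbb{R}}\psi(w)\frac{e^{-w^2/2}}{\sqrt{2\pi}}\,dw\right|\le\frac16\left(1+2\sqrt{\frac2\pi}\right)\|\psi'''\|_\infty\,\frac{\rho(t_1,\dots,t_n,x)}{\sqrt{N}\,\sigma(t_1,\dots,t_n,x)^3},$$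 where $\rho(t_1,\dots,t_n,x)=\mathbb{E}^{(x,0)}\big|u(M_{T_{t_1}},\dots,M_{T_{t_n}})-q(t_1,\dots,t_n,x)\big|^3$.
   Context: $M=(M_t)_{t\ge0}$ is a Feller process on $\mathbb{R}^d$ and $\sigma=(\sigma_t)_{t\ge0}$ is an independent strictly increasing subordinator (drift $b\ge0$, Lévy measure $\nu$ on $(0,\infty)$ with $\int(1\wedge s)\nu(ds)<\infty$, and $b>0$ or $\nu(0,\infty)=\infty$). Under $\mathbb{P}^{(x,0)}$, $M_0=x$ and $\sigma_0=0$ a.s.; $\mathbb{E}^{(x,0)}$ is the corresponding expectation. Put $L_t=\inf\{s\ge0:\sigma_s>t\}$ (inverse), $H_t=\sigma_{L_t-}$ (undershooting), $D_t=\sigma_{L_t}$ (overshooting). $T=(T_t)_{t\ge0}$ denotes any one of the three processes $L$, $H$, $D$, and $\mu_t(dw)=\mathbb{P}^{(x,0)}(T_t\in dw)$ (which does not depend on $x$). Put $q(t_1,\dots,t_n,x)=\mathbb{E}^{(x,0)}[u(M_{T_{t_1}},\dots,M_{T_{t_n}})]$ and $$q_N(t_1,\dots,t_n)=\frac1N\sum_{k=1}^N u\big(M^k_{T^k_{t_1}},\dots,M^k_{T^k_{t_n}}\big),$$ where $(M^k,T^k)$, $k=1,2,\dots$, are i.i.d. copies of $(M,T)$. The notation $u(x)\stackrel{\infty}{=}O(g(x))$ means $\limsup_{|x|\to+\infty}|u(x)/g(x)|<+\infty$. $C_b$ denotes bounded continuous functions and $C_b^3$ three times continuously differentiable functions,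 bounded together with their derivatives. The standard deviation $\sigma(t_1,\dots,t_n,x)$ is not to be confused with the subordinator $\sigma_t$. *)

theory Defs
  imports "HOL-Probability.Probability"
begin

text \<open>Processes are indexed by \<open>real\<close>; only the times in \<open>{0..}\<close> are meaningful.\<close>

definition cadlag :: "(real \<Rightarrow> 'a::topological_space) \<Rightarrow> bool" where
  "cadlag f \<longleftrightarrow>
     (\<forall>t\<ge>0. (f \<longlongrightarrow> f t) (at_right t)) \<and> (\<forall>t>0. \<exists>l. (f \<longlongrightarrow> l) (at_left t))"

definition trajectory :: "(real \<Rightarrow> 'w \<Rightarrow> 'a) \<Rightarrow> 'w \<Rightarrow> real \<Rightarrow> 'a" where
  "trajectory X \<omega> = (\<lambda>t\<in>{0..}. X t \<omega>)"

definition path_space :: "(real \<Rightarrow> 'a::topological_space) measure" where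
  "path_space = (\<Pi>\<^sub>M t\<in>{0..}. borel)"

text \<open>The library's \<open>indep_var\<close> needs both variables to have the same value type, hence the
  sigma-algebras generated by the two trajectories are used instead.\<close>

definition indep_processes ::
    "'w measure \<Rightarrow> (real \<Rightarrow> 'w \<Rightarrow> 'a::topological_space) \<Rightarrow> (real \<Rightarrow> 'w \<Rightarrow> 'b::topological_space) \<Rightarrow> bool"
  where
  "indep_processes R X Y \<longleftrightarrow>
     prob_space.indep_set R {trajectory X -` A \<inter> space R | A. A \<in> sets path_space}
                            {trajectory Y -` B \<inter> space R | B. B \<in> sets path_space}"

definition natural_filtration ::
    "'w measure \<Rightarrow> (real \<Rightarrow> 'w \<Rightarrow> 'a::topological_space) \<Rightarrow> real \<Rightarrow> 'w measure" where
  "natural_filtration R X s =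
     sigma (space R) {X r -` A \<inter> space R | r A. 0 \<le> r \<and> r \<le> s \<and> A \<in> sets borel}"

text \<open>\<open>C\<^sub>0\<close>: continuous functions vanishing at infinity.\<close>

definition C0 :: "('a::real_normed_vector \<Rightarrow> real) set" where
  "C0 = {f. continuous_on UNIV f \<and> (f \<longlongrightarrow> 0) at_infinity}"

definition transition_op ::
    "('a \<Rightarrow> 'w measure) \<Rightarrow> (real \<Rightarrow> 'w \<Rightarrow> 'a) \<Rightarrow> real \<Rightarrow> ('a \<Rightarrow> real) \<Rightarrow> 'a \<Rightarrow> real" where
  "transition_op P M t f y = (\<integral>\<omega>. f (M t \<omega>) \<partial>P y)"

text \<open>\<open>P x\<close> is the law under which the process starts at \<open>x\<close>; all these laws live on one
  measurable space. The Markov property is required for the natural filtration only. The process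
  is conservative (no cemetery state).\<close>

definition feller_process ::
    "('a::euclidean_space \<Rightarrow> 'w measure) \<Rightarrow> (real \<Rightarrow> 'w \<Rightarrow> 'a) \<Rightarrow> bool" where
  "feller_process P M \<longleftrightarrow>
     (\<forall>x. prob_space (P x)) \<and>
     (\<forall>x y. sets (P x) = sets (P y)) \<and>
     (\<forall>x. \<forall>t\<ge>0. M t \<in> borel_measurable (P x)) \<and>
     (\<forall>x. \<forall>\<omega>\<in>space (P x). cadlag (\<lambda>t. M t \<omega>)) \<and>
     (\<forall>x. AE \<omega> in P x. M 0 \<omega> = x) \<and>
     (\<forall>x. \<forall>s\<ge>0. \<forall>t\<ge>0. \<forall>f\<in>C0. AE \<omega> in P x.
        real_cond_exp (P x) (natural_filtration (P x) M s) (\<lambda>\<omega>. f (M (s + t) \<omega>)) \<omega>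
          = transition_op P M t f (M s \<omega>)) \<and>
     (\<forall>t\<ge>0. \<forall>f\<in>C0. transition_op P M t f \<in> C0) \<and>
     (\<forall>f\<in>C0. uniform_limit UNIV (\<lambda>t. transition_op P M t f) f (at_right 0))"

definition levy_measure :: "real measure \<Rightarrow> bool" where
  "levy_measure \<nu> \<longleftrightarrow>
     sets \<nu> = sets borel \<and> emeasure \<nu> {..0} = 0 \<and> (\<integral>\<^sup>+ s. ennreal (min 1 s) \<partial>\<nu>) < \<infinity>"

definition laplace_exponent :: "real \<Rightarrow> real measure \<Rightarrow> real \<Rightarrow> real" where
  "laplace_exponent b \<nu> \<theta> = b * \<theta> + (\<integral>s. (1 - exp (- \<theta> * s)) \<partial>\<nu>)"

text \<open>The last clause makes the paths almost surely strictly increasing.\<close>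

definition strict_subordinator ::
    "'w measure \<Rightarrow> real \<Rightarrow> real measure \<Rightarrow> (real \<Rightarrow> 'w \<Rightarrow> real) \<Rightarrow> bool" where
  "strict_subordinator R b \<nu> \<sigma> \<longleftrightarrow>
     prob_space R \<and>
     (\<forall>t\<ge>0. \<sigma> t \<in> borel_measurable R) \<and>
     (\<forall>\<omega>\<in>space R. cadlag (\<lambda>t. \<sigma> t \<omega>) \<and> mono_on {0..} (\<lambda>t. \<sigma> t \<omega>) \<and> 0 \<le> \<sigma> 0 \<omega>) \<and>
     (AE \<omega> in R. \<sigma> 0 \<omega> = 0) \<and>
     (\<forall>\<tau>::nat \<Rightarrow> real. 0 \<le> \<tau> 0 \<longrightarrow> mono \<tau> \<longrightarrow>
        prob_space.indep_vars R (\<lambda>_. borel) (\<lambda>i \<omega>. \<sigma> (\<tau> (Suc i)) \<omega> - \<sigma> (\<tau> i) \<omega>) UNIV) \<and>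
     (\<forall>s t. 0 \<le> s \<longrightarrow> s \<le> t \<longrightarrow>
        distr R borel (\<lambda>\<omega>. \<sigma> t \<omega> - \<sigma> s \<omega>) = distr R borel (\<sigma> (t - s))) \<and>
     0 \<le> b \<and> levy_measure \<nu> \<and>
     (\<forall>t\<ge>0. \<forall>\<theta>\<ge>0. (\<integral>\<omega>. exp (- \<theta> * \<sigma> t \<omega>) \<partial>R) = exp (- t * laplace_exponent b \<nu> \<theta>)) \<and>
     (b > 0 \<or> emeasure \<nu> {0<..} = \<infinity>)"

text \<open>On the null set where a path of \<open>\<sigma>\<close> stays below \<open>t\<close> the infimum would be infinite;
  there \<open>L\<close> is set to \<open>0\<close>, so that it is a real-valued process for every outcome.\<close>

definition inverse_process :: "(real \<Rightarrow> 'w \<Rightarrow> real) \<Rightarrow> real \<Rightarrow> 'w \<Rightarrow> real" where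
  "inverse_process \<sigma> t \<omega> =
     (if \<exists>s\<ge>0. \<sigma> s \<omega> > t then Inf {s. 0 \<le> s \<and> \<sigma> s \<omega> > t} else 0)"

text \<open>Left limit at \<open>l\<close>, with the convention \<open>\<sigma>\<^bsub>0-\<^esub> = \<sigma>\<^sub>0\<close>.\<close>

definition left_value :: "(real \<Rightarrow> 'w \<Rightarrow> real) \<Rightarrow> real \<Rightarrow> 'w \<Rightarrow> real" where
  "left_value \<sigma> l \<omega> = (if l > 0 then Lim (at_left l) (\<lambda>s. \<sigma> s \<omega>) else \<sigma> 0 \<omega>)"

definition undershooting :: "(real \<Rightarrow> 'w \<Rightarrow> real) \<Rightarrow> real \<Rightarrow> 'w \<Rightarrow> real" where
  "undershooting \<sigma> t \<omega> = left_value \<sigma> (inverse_process \<sigma> t \<omega>) \<omega>"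

definition overshooting :: "(real \<Rightarrow> 'w \<Rightarrow> real) \<Rightarrow> real \<Rightarrow> 'w \<Rightarrow> real" where
  "overshooting \<sigma> t \<omega> = \<sigma> (inverse_process \<sigma> t \<omega>) \<omega>"

text \<open>\<open>(M' k, T' k)\<close>, \<open>k \<ge> 1\<close>, on \<open>Q\<close> are independent and each has the law of \<open>(M, T)\<close> under \<open>R\<close>
  as a process. The law on the product space does not determine regularity of paths, hence the
  copies of \<open>M\<close> are required to be cadlag and those of \<open>T\<close> to be nonnegative, as the originals are.\<close>

definition iid_copies ::
    "'v measure \<Rightarrow> (nat \<Rightarrow> real \<Rightarrow> 'v \<Rightarrow> 'a::euclidean_space) \<Rightarrow> (nat \<Rightarrow> real \<Rightarrow> 'v \<Rightarrow> real) \<Rightarrow>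
     'w measure \<Rightarrow> (real \<Rightarrow> 'w \<Rightarrow> 'a) \<Rightarrow> (real \<Rightarrow> 'w \<Rightarrow> real) \<Rightarrow> bool" where
  "iid_copies Q M' T' R M T \<longleftrightarrow>
     prob_space Q \<and>
     (\<forall>k\<ge>1. \<forall>\<omega>\<in>space Q. cadlag (\<lambda>t. M' k t \<omega>) \<and> (\<forall>t\<ge>0. 0 \<le> T' k t \<omega>)) \<and>
     prob_space.indep_vars Q (\<lambda>_. path_space \<Otimes>\<^sub>M path_space)
       (\<lambda>k \<omega>. (trajectory (M' k) \<omega>, trajectory (T' k) \<omega>)) {1..} \<and>
     (\<forall>k\<ge>1. distr Q (path_space \<Otimes>\<^sub>M path_space) (\<lambda>\<omega>. (trajectory (M' k) \<omega>, trajectory (T' k) \<omega>))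
            = distr R (path_space \<Otimes>\<^sub>M path_space) (\<lambda>\<omega>. (trajectory M \<omega>, trajectory T \<omega>)))"

definition locally_bounded :: "('a::topological_space \<Rightarrow> real) \<Rightarrow> bool" where
  "locally_bounded f \<longleftrightarrow> (\<forall>x. \<exists>U. open U \<and> x \<in> U \<and> bounded (f ` U))"

text \<open>\<open>r\<close> is the order of the moment: \<open>r = 2 * p\<close> or \<open>r = 3 * p\<close>; \<open>\<mu>\<^sub>t\<close> is the law of \<open>T t\<close>.\<close>

definition tail_condition ::
    "'w measure \<Rightarrow> (real \<Rightarrow> 'w \<Rightarrow> 'a::euclidean_space) \<Rightarrow> (real \<Rightarrow> 'w \<Rightarrow> real) \<Rightarrow> real \<Rightarrow> real \<Rightarrow> bool"
  where
  "tail_condition R M T r t \<longleftrightarrow>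
     (\<integral>\<^sup>+ w \<in> {0..}. (\<integral>\<^sup>+ s \<in> {1..}. ennreal (s powr (r - 1)) *
        emeasure R {\<omega> \<in> space R. norm (M w \<omega>) > s} \<partial>lborel) \<partial>distr R borel (T t)) < \<infinity>"

definition sampled ::
    "(real \<Rightarrow> 'w \<Rightarrow> 'a) \<Rightarrow> (real \<Rightarrow> 'w \<Rightarrow> real) \<Rightarrow> ('n::finite \<Rightarrow> real) \<Rightarrow> 'w \<Rightarrow> 'a ^ 'n" where
  "sampled M T t \<omega> = (\<chi> i. M (T (t i) \<omega>) \<omega>)"

definition q_mean ::
    "'w measure \<Rightarrow> (real \<Rightarrow> 'w \<Rightarrow> 'a) \<Rightarrow> (real \<Rightarrow> 'w \<Rightarrow> real) \<Rightarrow> ('a ^ 'n \<Rightarrow> real) \<Rightarrow>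
     ('n::finite \<Rightarrow> real) \<Rightarrow> real" where
  "q_mean R M T u t = (\<integral>\<omega>. u (sampled M T t \<omega>) \<partial>R)"

definition q_sd ::
    "'w measure \<Rightarrow> (real \<Rightarrow> 'w \<Rightarrow> 'a) \<Rightarrow> (real \<Rightarrow> 'w \<Rightarrow> real) \<Rightarrow> ('a ^ 'n \<Rightarrow> real) \<Rightarrow>
     ('n::finite \<Rightarrow> real) \<Rightarrow> real" where
  "q_sd R M T u t = sqrt (\<integral>\<omega>. (u (sampled M T t \<omega>) - q_mean R M T u t)\<^sup>2 \<partial>R)"

definition q_rho ::
    "'w measure \<Rightarrow> (real \<Rightarrow> 'w \<Rightarrow> 'a) \<Rightarrow> (real \<Rightarrow> 'w \<Rightarrow> real) \<Rightarrow> ('a ^ 'n \<Rightarrow> real) \<Rightarrow>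
     ('n::finite \<Rightarrow> real) \<Rightarrow> real" where
  "q_rho R M T u t = (\<integral>\<omega>. \<bar>u (sampled M T t \<omega>) - q_mean R M T u t\<bar> ^ 3 \<partial>R)"

definition q_emp ::
    "(nat \<Rightarrow> real \<Rightarrow> 'v \<Rightarrow> 'a) \<Rightarrow> (nat \<Rightarrow> real \<Rightarrow> 'v \<Rightarrow> real) \<Rightarrow> ('a ^ 'n \<Rightarrow> real) \<Rightarrow>
     ('n::finite \<Rightarrow> real) \<Rightarrow> nat \<Rightarrow> 'v \<Rightarrow> real" where
  "q_emp M' T' u t N \<omega> = (\<Sum>k=1..N. u (sampled (M' k) (T' k) t \<omega>)) / real N"

text \<open>\<open>C\<^sub>b\<^sup>3(\<real>)\<close>.\<close>

definition Cb3 :: "(real \<Rightarrow> real) set" where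
  "Cb3 = {\<psi>. (\<forall>k<3. \<forall>w. (deriv ^^ k) \<psi> differentiable at w) \<and> (\<forall>k\<le>3. (deriv ^^ k) \<psi> \<in> bcontfun)}"

definition gauss_integral :: "(real \<Rightarrow> real) \<Rightarrow> real" where
  "gauss_integral \<psi> = (\<integral>w. \<psi> w * (exp (- (w\<^sup>2) / 2) / sqrt (2 * pi)) \<partial>lborel)"

end

theory Submission
  imports Defs
begin

text \<open>Since \<open>M\<close> is cadlag, \<open>M\<close> sampled at the times \<open>T\<close> is a measurable functional of the trajectories
  of \<open>M\<close> and \<open>T\<close>, so the copies yield an i.i.d. sequence of real variables. \<open>T\<close> is a functional
  of \<open>\<sigma>\<close>, hence independent of \<open>M\<close>, and conditioning on \<open>T\<close> together with the layer cake formula turns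
  the tail conditions into second or third moments of their law. The classical central limit theorem
  gives the convergence. For the rate, Lindeberg's argument replaces the standardised summands \<open>X\<close>
  one by one by standard normal variables \<open>Z\<close>; by Taylor expansion each replacement costs
  at most \<open>(E|X|^3 + E|Z|^3) / (6 N sqrt N)\<close> times the supremum of the third derivative of \<open>\<psi>\<close>. The
  constant comes from \<open>E|Z|^3 = 2 sqrt (2 / \<pi>)\<close> and \<open>1 \<le> E|X|^3\<close>.\<close>

section \<open>Normal approximation by replacement of the summands\<close>

text \<open>Lagrange's form of the remainder for \<open>h \<mapsto> f (y + h)\<close> at 0, valid
  for both signs of \<open>h\<close>; the constant is \<open>K / 3!\<close>.\<close>

lemma third_order_taylor_bound:
  fixes f :: "real \<Rightarrow> real"
  assumes diff: "\<And>k w. k < 3 \<Longrightarrow> (deriv ^^ k) f differentiable at w"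
    and bound: "\<And>w. \<bar>(deriv ^^ 3) f w\<bar> \<le> K"
  shows "\<bar>f (y + h) - (f y + deriv f y * h + deriv (deriv f) y / 2 * h\<^sup>2)\<bar> \<le> K / 6 * \<bar>h\<bar> ^ 3"
proof -
  have DERIV: "((deriv ^^ m) f has_real_derivative (deriv ^^ Suc m) f w) (at w)" if "m < 3" for m w
    using diff[OF that, of w] DERIV_deriv_iff_real_differentiable by simp
  have shift: "((\<lambda>h. (deriv ^^ m) f (y + h)) has_real_derivative (deriv ^^ Suc m) f (y + w)) (at w)"
    if "m < 3" for m w
    using DERIV[OF that, of "w + y"] DERIV_shift[of "(deriv ^^ m) f" _ w y] by (simp add: add.commute)
  have "\<exists>t. \<bar>t\<bar> \<le> \<bar>h\<bar> \<and> f (y + h) =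
      (\<Sum>m<3. (deriv ^^ m) f (y + 0) / fact m * h ^ m) + (deriv ^^ 3) f (y + t) / fact 3 * h ^ 3"
    using shift by (intro Maclaurin_bi_le[where f = "\<lambda>h. f (y + h)"]) auto
  then obtain t where t: "f (y + h) =
      (\<Sum>m<3. (deriv ^^ m) f (y + 0) / fact m * h ^ m) + (deriv ^^ 3) f (y + t) / fact 3 * h ^ 3"
    by blast
  have "f (y + h) - (f y + deriv f y * h + deriv (deriv f) y / 2 * h\<^sup>2) = (deriv ^^ 3) f (y + t) / 6 * h ^ 3"
    unfolding t by (simp add: eval_nat_numeral)
  also have "\<bar>\<dots>\<bar> = \<bar>(deriv ^^ 3) f (y + t)\<bar> / 6 * \<bar>h\<bar> ^ 3"
    by (simp add: abs_mult power_abs)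
  also have "\<dots> \<le> K / 6 * \<bar>h\<bar> ^ 3"
    using bound by (intro mult_right_mono divide_right_mono) auto
  finally show ?thesis .
qed

text \<open>Lower powers are dominated by \<open>1 + |z| ^ 3\<close>, whose constant part is
  integrable because the measure is finite.\<close>

lemma integrable_lower_moments:
  fixes X :: "'a \<Rightarrow> real"
  assumes "prob_space m" and [measurable]: "X \<in> borel_measurable m"
    and int: "integrable m (\<lambda>x. \<bar>X x\<bar> ^ 3)"
  shows "integrable m X" "integrable m (\<lambda>x. (X x)\<^sup>2)"
proof -
  interpret prob_space m by fact
  have int1: "integrable m (\<lambda>x. 1 + \<bar>X x\<bar> ^ 3)"
    using int by auto
  have *: "\<bar>z\<bar> ^ k \<le> 1 + \<bar>z\<bar> ^ 3" if "k \<le> 3" for z :: real and k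
  proof (cases "\<bar>z\<bar> \<le> 1")
    case True
    then have "\<bar>z\<bar> ^ k \<le> 1" by (simp add: power_le_one)
    then show ?thesis by (smt (verit) zero_le_power abs_ge_zero)
  next
    case False
    then have "\<bar>z\<bar> ^ k \<le> \<bar>z\<bar> ^ 3" using that by (intro power_increasing) auto
    then show ?thesis by simp
  qed
  show "integrable m X"
    by (rule Bochner_Integration.integrable_bound[OF int1]) (use *[of 1] in auto)
  show "integrable m (\<lambda>x. (X x)\<^sup>2)"
    by (rule Bochner_Integration.integrable_bound[OF int1]) (use *[of 2] in auto)
qed

text \<open>Integrating the Taylor bound removes the linear term, as the mean is 0, and leaves a
  main term that depends on the law only through its variance \<open>v\<close>. Two centred laws of
  equal variance thus share it, and only third moments enter the error.\<close>

lemma second_order_expansion_integral: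
  fixes f :: "real \<Rightarrow> real"
  assumes "prob_space m" and [measurable_cong]: "sets m = sets borel"
    and mean: "(\<integral>x. x \<partial>m) = 0" and var: "(\<integral>x. x\<^sup>2 \<partial>m) = v" and int3: "integrable m (\<lambda>x. \<bar>x\<bar> ^ 3)"
    and diff: "\<And>k w. k < 3 \<Longrightarrow> (deriv ^^ k) f differentiable at w"
    and bound: "\<And>w. \<bar>(deriv ^^ 3) f w\<bar> \<le> K"
    and cont: "continuous_on UNIV f" and bdd: "\<And>w. \<bar>f w\<bar> \<le> B"
  shows "\<bar>(\<integral>x. f (y + x) \<partial>m) - (f y + deriv (deriv f) y / 2 * v)\<bar> \<le> K / 6 * (\<integral>x. \<bar>x\<bar> ^ 3 \<partial>m)"
proof -
  interpret prob_space m by fact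
  have [measurable]: "f \<in> borel_measurable borel"
    using cont by (rule borel_measurable_continuous_onI)
  note int = integrable_lower_moments[OF assms(1) _ int3, simplified]
  have intf: "integrable m (\<lambda>x. f (y + x))"
    by (rule integrable_const_bound[where B = B]) (use bdd in auto)
  have "(\<integral>x. f (y + x) - (f y + deriv f y * x + deriv (deriv f) y / 2 * x\<^sup>2) \<partial>m)
      = (\<integral>x. f (y + x) \<partial>m) - (f y + deriv (deriv f) y / 2 * v)"
    using intf int mean var by (simp add: prob_space)
  moreover have "\<bar>\<integral>x. f (y + x) - (f y + deriv f y * x + deriv (deriv f) y / 2 * x\<^sup>2) \<partial>m\<bar>
      \<le> (\<integral>x. K / 6 * \<bar>x\<bar> ^ 3 \<partial>m)"
    using intf int int3 third_order_taylor_bound[OF diff bound]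
    by (intro order_trans[OF integral_abs_bound] integral_mono) auto
  ultimately show ?thesis by simp
qed

text \<open>Fubini for a bounded integrand. The second equation lets either summand be integrated
  first, which is how a one-step law is brought next to \<open>f\<close>.\<close>

lemma integral_convolution:
  fixes f :: "real \<Rightarrow> real"
  assumes "prob_space m" "prob_space g" and [measurable_cong]: "sets m = sets borel" "sets g = sets borel"
    and [measurable]: "f \<in> borel_measurable borel" and bdd: "\<And>w. \<bar>f w\<bar> \<le> B"
  shows "(\<integral>w. f w \<partial>(m \<star> g)) = (\<integral>x. \<integral>y. f (x + y) \<partial>g \<partial>m)"
    and "(\<integral>x. \<integral>y. f (x + y) \<partial>g \<partial>m) = (\<integral>y. \<integral>x. f (x + y) \<partial>m \<partial>g)"
proof -
  interpret m: prob_space m by fact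
  interpret g: prob_space g by fact
  interpret pair_prob_space m g ..
  have int: "integrable (m \<Otimes>\<^sub>M g) (\<lambda>(x, y). f (x + y))"
    by (rule integrable_const_bound[where B = B]) (use bdd in auto)
  have "(\<integral>w. f w \<partial>(m \<star> g)) = (\<integral>p. f (fst p + snd p) \<partial>(m \<Otimes>\<^sub>M g))"
    unfolding convolution_def by (subst integral_distr) (auto simp: case_prod_beta)
  also have "\<dots> = (\<integral>x. \<integral>y. f (x + y) \<partial>g \<partial>m)"
    using integral_fst'[OF int] by (simp add: case_prod_unfold)
  finally show "(\<integral>w. f w \<partial>(m \<star> g)) = (\<integral>x. \<integral>y. f (x + y) \<partial>g \<partial>m)" .
  show "(\<integral>x. \<integral>y. f (x + y) \<partial>g \<partial>m) = (\<integral>y. \<integral>x. f (x + y) \<partial>m \<partial>g)"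
    using Fubini_integral[OF int] by simp
qed

lemma integral_diff_bounded:
  fixes f h :: "real \<Rightarrow> real"
  assumes "prob_space m" and [measurable]: "f \<in> borel_measurable m" "h \<in> borel_measurable m"
    and "\<And>w. \<bar>f w\<bar> \<le> B" "\<And>w. \<bar>h w\<bar> \<le> B" and c: "\<And>w. \<bar>f w - h w\<bar> \<le> c"
  shows "\<bar>(\<integral>w. f w \<partial>m) - (\<integral>w. h w \<partial>m)\<bar> \<le> c"
proof -
  interpret prob_space m by fact
  have int: "integrable m f" "integrable m h"
    by (rule integrable_const_bound[where B = B]; use assms in auto)+
  have "\<bar>\<integral>w. f w - h w \<partial>m\<bar> \<le> (\<integral>w. c \<partial>m)"
    using int c by (intro order_trans[OF integral_abs_bound] integral_mono) auto
  then show ?thesis using int by (simp add: prob_space)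
qed

lemma abs_integral_le_bound:
  fixes f :: "real \<Rightarrow> real"
  assumes "prob_space m" "\<And>w. \<bar>f w\<bar> \<le> B" and [measurable]: "f \<in> borel_measurable m"
  shows "\<bar>\<integral>w. f w \<partial>m\<bar> \<le> B"
proof -
  have "\<bar>(\<integral>w. f w \<partial>m) - (\<integral>w. 0 \<partial>m)\<bar> \<le> B"
    by (rule integral_diff_bounded[where B = B])
       (use assms order_trans[OF abs_ge_zero assms(2)] in auto)
  then show ?thesis by simp
qed

text \<open>Lindeberg's replacement of the summands one at a time. Convolutions commute, so the difference
  of the one-step laws is always applied to \<open>f\<close> itself and no regularity of the convolved
  functions is needed.\<close>

lemma convolution_powers_bound:
  fixes m g :: "nat \<Rightarrow> real measure" and f :: "real \<Rightarrow> real"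
  assumes prob: "\<And>n. prob_space (m n)" "\<And>n. prob_space (g n)"
    and sets [measurable_cong]: "\<And>n. sets (m n) = sets borel" "\<And>n. sets (g n) = sets borel"
    and conv: "\<And>n. m (Suc n) = (m 0 \<star> m n)" "\<And>n. g (Suc n) = (g 0 \<star> g n)"
    and [measurable]: "f \<in> borel_measurable borel" and bdd: "\<And>w. \<bar>f w\<bar> \<le> B"
    and step: "\<And>y. \<bar>(\<integral>x. f (y + x) \<partial>m 0) - (\<integral>x. f (y + x) \<partial>g 0)\<bar> \<le> c"
  shows "\<bar>(\<integral>x. f (y + x) \<partial>m n) - (\<integral>x. f (y + x) \<partial>g n)\<bar> \<le> real (Suc n) * c"
\<comment> \<open>\<open>m n\<close> is the law of \<open>n + 1\<close> summands, whence the factor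
  \<open>Suc n\<close> and the one-step bound as base case. The shift \<open>y\<close> has to vary
  because the remaining summand is absorbed into it.\<close>
proof (induction n arbitrary: y)
  case 0
  then show ?case using step by simp
next
  case (Suc n)
  interpret m: sigma_finite_measure "m k" for k
    using prob(1) by (simp add: prob_space_imp_sigma_finite)
  interpret g: sigma_finite_measure "g k" for k
    using prob(2) by (simp add: prob_space_imp_sigma_finite)
  have bd: "\<bar>\<integral>x. f (z + x) \<partial>m k\<bar> \<le> B" "\<bar>\<integral>x. f (z + x) \<partial>g k\<bar> \<le> B" for z k
    using prob bdd by (auto intro!: abs_integral_le_bound)
  have "(\<integral>x. f (y + x) \<partial>m (Suc n)) = (\<integral>x. \<integral>w. f (y + (x + w)) \<partial>m n \<partial>m 0)"
    unfolding conv by (rule integral_convolution[where B = B]) (use prob sets bdd in auto)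
  also have "\<dots> = (\<integral>w. \<integral>x. f (y + w + x) \<partial>m 0 \<partial>m n)"
    by (subst integral_convolution(2)[where f = "\<lambda>x. f (y + x)" and B = B])
       (use prob sets bdd in \<open>auto simp: ac_simps\<close>)
  finally have 1: "(\<integral>x. f (y + x) \<partial>m (Suc n)) = (\<integral>w. \<integral>x. f (y + w + x) \<partial>m 0 \<partial>m n)" .
  \<comment> \<open>The mixed law \<open>g 0 \<star> m n\<close> is the intermediate point: passing
    from \<open>m 0\<close> to \<open>g 0\<close> under \<open>m n\<close> costs \<open>c\<close>,
    and then passing from \<open>m n\<close> to \<open>g n\<close> under \<open>g 0\<close> costs
    \<open>Suc n * c\<close> by induction.\<close>
  have "(\<integral>w. \<integral>x. f (y + w + x) \<partial>g 0 \<partial>m n) = (\<integral>x. \<integral>w. f (y + x + w) \<partial>m n \<partial>g 0)"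
    using integral_convolution(2)[where f = "\<lambda>x. f (y + x)" and B = B and m = "m n" and g = "g 0"]
      prob sets bdd by (simp add: ac_simps)
  moreover have "(\<integral>x. f (y + x) \<partial>g (Suc n)) = (\<integral>x. \<integral>w. f (y + x + w) \<partial>g n \<partial>g 0)"
    unfolding conv
    by (subst integral_convolution(1)[where B = B]) (use prob sets bdd in \<open>auto simp: ac_simps\<close>)
  moreover have "\<bar>(\<integral>w. \<integral>x. f (y + w + x) \<partial>m 0 \<partial>m n) - (\<integral>w. \<integral>x. f (y + w + x) \<partial>g 0 \<partial>m n)\<bar> \<le> c"
    by (rule integral_diff_bounded[where B = B]) (use prob bd step in auto)
  moreover have "\<bar>(\<integral>x. \<integral>w. f (y + x + w) \<partial>m n \<partial>g 0) - (\<integral>x. \<integral>w. f (y + x + w) \<partial>g n \<partial>g 0)\<bar>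
      \<le> real (Suc n) * c"
    by (rule integral_diff_bounded[where B = B]) (use prob bd Suc.IH in auto)
  ultimately have "\<bar>(\<integral>x. f (y + x) \<partial>m (Suc n)) - (\<integral>x. f (y + x) \<partial>g (Suc n))\<bar> \<le> c + real (Suc n) * c"
    using 1 by linarith
  then show ?case by (simp add: algebra_simps)
qed

section \<open>Centred normal laws and limit theorems for i.i.d. sums\<close>

lemma normal_density_convolution:
  assumes "0 < s" "0 < r"
  shows "(density lborel (normal_density 0 s) \<star> density lborel (normal_density 0 r))
    = density lborel (normal_density 0 (sqrt (s\<^sup>2 + r\<^sup>2)))"
proof -
  have "finite_measure (density lborel (normal_density 0 s))" "finite_measure (density lborel (normal_density 0 r))"
    using prob_space_normal_density[OF assms(1)] prob_space_normal_density[OF assms(2)]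
    by (auto simp: prob_space.finite_measure)
  then show ?thesis
    using conv_normal_density_zero_mean[OF assms]
    by (subst convolution_density) (auto simp: ennreal_mult'[symmetric] normal_density_nonneg)
qed

text \<open>The third absolute moment is the case \<open>k = 1\<close> of
  \<open>2 ^ k * k! * s ^ (2 * k + 1) * sqrt (2 / pi)\<close>.\<close>

lemma normal_moments:
  assumes [arith]: "0 < s"
  shows "(\<integral>x. x \<partial>density lborel (normal_density 0 s)) = 0"
    "(\<integral>x. x\<^sup>2 \<partial>density lborel (normal_density 0 s)) = s\<^sup>2"
    "integrable (density lborel (normal_density 0 s)) (\<lambda>x. \<bar>x\<bar> ^ 3)"
    "(\<integral>x. \<bar>x\<bar> ^ 3 \<partial>density lborel (normal_density 0 s)) = 2 * sqrt (2 / pi) * s ^ 3"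
  using integral_normal_moment_nz_1[OF assms, of 0] integral_normal_moment_even[OF assms, of 0 1]
    integrable_normal_moment_abs[OF assms, of 0 3] integral_normal_moment_abs_odd[OF assms, of 0 1]
  by (simp_all add: integral_density integrable_density normal_density_nonneg)

text \<open>Integrate \<open>3 z^2 \<le> 1 + 2 |z|^3\<close>, which is
  \<open>(|z| - 1)^2 (2 |z| + 1) \<ge> 0\<close> expanded. This later absorbs the Gaussian third
  moment into that of the summands.\<close>

lemma (in prob_space) second_moment_le_third_moment:
  fixes X :: "'a \<Rightarrow> real"
  assumes [measurable]: "X \<in> borel_measurable M"
    and "expectation (\<lambda>x. (X x)\<^sup>2) = 1" and int: "integrable M (\<lambda>x. \<bar>X x\<bar> ^ 3)"
  shows "1 \<le> expectation (\<lambda>x. \<bar>X x\<bar> ^ 3)"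
proof -
  have *: "3 * (X x)\<^sup>2 \<le> 1 + 2 * \<bar>X x\<bar> ^ 3" for x
  proof -
    have "0 \<le> (\<bar>X x\<bar> - 1)\<^sup>2 * (2 * \<bar>X x\<bar> + 1)" by simp
    also have "\<dots> = 1 + 2 * \<bar>X x\<bar> ^ 3 - 3 * \<bar>X x\<bar>\<^sup>2"
      by (simp only: power2_eq_square power3_eq_cube) (simp add: algebra_simps)
    finally show ?thesis by simp
  qed
  have "expectation (\<lambda>x. 3 * (X x)\<^sup>2) \<le> expectation (\<lambda>x. 1 + 2 * \<bar>X x\<bar> ^ 3)"
    using integrable_lower_moments(2)[OF prob_space_axioms assms(1) int] int *
    by (intro integral_mono) auto
  then show ?thesis using assms int by (simp add: prob_space)
qed

text \<open>After scaling by \<open>a = 1 / sqrt N\<close>, each exchange of a summand for a centred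
  normal of variance \<open>1 / N\<close> costs a multiple of \<open>a ^ 3\<close>; the
  \<open>N\<close> exchanges together cost \<open>N * a ^ 3 = 1 / sqrt N\<close> times the same
  factor.\<close>

lemma (in prob_space) normal_approximation_third_moment:
  fixes X :: "nat \<Rightarrow> 'a \<Rightarrow> real" and f :: "real \<Rightarrow> real"
  assumes indep: "indep_vars (\<lambda>_. borel) X UNIV"
    and law: "\<And>k. distr M borel (X k) = law"
    and mean: "(\<integral>x. x \<partial>law) = 0" and var: "(\<integral>x. x\<^sup>2 \<partial>law) = 1"
    and int3: "integrable law (\<lambda>x. \<bar>x\<bar> ^ 3)"
    and diff: "\<And>k w. k < 3 \<Longrightarrow> (deriv ^^ k) f differentiable at w"
    and bound: "\<And>w. \<bar>(deriv ^^ 3) f w\<bar> \<le> K"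
    and bdd: "\<And>w. \<bar>f w\<bar> \<le> B"
    and N: "1 \<le> N"
  shows "\<bar>expectation (\<lambda>\<omega>. f ((\<Sum>k<N. X k \<omega>) / sqrt (real N))) - (\<integral>x. f x \<partial>std_normal_distribution)\<bar>
    \<le> K / 6 * ((\<integral>x. \<bar>x\<bar> ^ 3 \<partial>law) + 2 * sqrt (2 / pi)) / sqrt (real N)"
proof -
  define a where "a = 1 / sqrt (real N)"
  have a: "0 < a" "a\<^sup>2 * N = 1" using N by (auto simp: a_def power_divide)
  have X[measurable]: "X k \<in> borel_measurable M" for k
    using indep unfolding indep_vars_def2 by simp
  have "continuous_on UNIV f"
    using diff[of 0] by (auto intro!: continuous_at_imp_continuous_on differentiable_imp_continuous_within)
  note cont = this
  have [measurable]: "f \<in> borel_measurable borel"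
    using cont by (rule borel_measurable_continuous_onI)
  \<comment> \<open>\<open>m n\<close> and \<open>g n\<close> carry \<open>Suc n\<close> summands,
    so the case wanted is \<open>n = N - 1\<close>; there \<open>a * sqrt N = 1\<close> and
    \<open>g (N - 1)\<close> is standard normal.\<close>
  define m where "m n = distr M borel (\<lambda>\<omega>. \<Sum>k<Suc n. a * X k \<omega>)" for n
  define g where "g n = density lborel (normal_density 0 (a * sqrt (real (Suc n))))" for n
  have pm: "prob_space (m n)" for n unfolding m_def by (rule prob_space_distr) measurable
  have pg: "prob_space (g n)" for n unfolding g_def using a by (intro prob_space_normal_density) auto
  have m0: "m 0 = distr law borel (\<lambda>x. a * x)"
    unfolding m_def law[of 0, symmetric] by (subst distr_distr) (auto simp: comp_def)
  have [measurable_cong]: "sets law = sets borel" using law[of 0] by auto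
  have Xlaw: "distr M borel (\<lambda>\<omega>. a * X k \<omega>) = m 0" for k
    unfolding m0 law[of k, symmetric] by (subst distr_distr) (auto simp: comp_def)
  have indep': "indep_vars (\<lambda>_. borel) (\<lambda>k \<omega>. a * X k \<omega>) I" for I
    using indep_vars_compose2[OF indep_vars_subset[OF indep], where Y = "\<lambda>_ x. a * x"] by auto
  have mSuc: "m (Suc n) = (m 0 \<star> m n)" for n
  proof -
    have "indep_var borel (\<lambda>\<omega>. a * X (Suc n) \<omega>) borel (\<lambda>\<omega>. \<Sum>k<Suc n. a * X k \<omega>)"
      by (rule indep_vars_sum) (auto intro: indep')
    from sum_indep_random_variable[OF this] show ?thesis
      unfolding Xlaw by (simp add: m_def ac_simps)
  qed
  have gSuc: "g (Suc n) = (g 0 \<star> g n)" for n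
  proof -
    have "(a * sqrt (real (Suc 0)))\<^sup>2 + (a * sqrt (real (Suc n)))\<^sup>2 = (a * sqrt (real (Suc (Suc n))))\<^sup>2"
      by (simp add: power_mult_distrib algebra_simps)
    then show ?thesis
      unfolding g_def using a(1) by (subst normal_density_convolution) auto
  qed
  have int_m: "(\<integral>x. \<bar>x\<bar> ^ 3 \<partial>m 0) = a ^ 3 * (\<integral>x. \<bar>x\<bar> ^ 3 \<partial>law)"
    using a unfolding m0 by (subst integral_distr) (auto simp: abs_mult power_mult_distrib)
  have int_g: "(\<integral>x. \<bar>x\<bar> ^ 3 \<partial>g 0) = a ^ 3 * (2 * sqrt (2 / pi))"
    unfolding g_def using normal_moments(4)[of a] a by simp
  let ?c = "K / 6 * (\<integral>x. \<bar>x\<bar> ^ 3 \<partial>m 0) + K / 6 * (\<integral>x. \<bar>x\<bar> ^ 3 \<partial>g 0)"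
  have step: "\<bar>(\<integral>x. f (y + x) \<partial>m 0) - (\<integral>x. f (y + x) \<partial>g 0)\<bar> \<le> ?c" for y
  proof -
    \<comment> \<open>Both one-step laws have mean 0 and variance \<open>a\<^sup>2\<close>, so both
      integrals are compared with the same second-order value.\<close>
    have "\<bar>(\<integral>x. f (y + x) \<partial>m 0) - (f y + deriv (deriv f) y / 2 * a\<^sup>2)\<bar> \<le> K / 6 * (\<integral>x. \<bar>x\<bar> ^ 3 \<partial>m 0)"
    proof (rule second_order_expansion_integral[OF pm _ _ _ _ diff bound cont bdd])
      show "(\<integral>x. x \<partial>m 0) = 0" "(\<integral>x. x\<^sup>2 \<partial>m 0) = a\<^sup>2" "integrable (m 0) (\<lambda>x. \<bar>x\<bar> ^ 3)"
        unfolding m0 using mean var int3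
        by (subst integral_distr integrable_distr_eq, auto simp: abs_mult power_mult_distrib)+
    qed (auto simp: m_def)
    moreover have "\<bar>(\<integral>x. f (y + x) \<partial>g 0) - (f y + deriv (deriv f) y / 2 * a\<^sup>2)\<bar> \<le> K / 6 * (\<integral>x. \<bar>x\<bar> ^ 3 \<partial>g 0)"
      by (rule second_order_expansion_integral[OF pg _ _ _ _ diff bound cont bdd])
         (use normal_moments[OF a(1)] in \<open>auto simp: g_def\<close>)
    ultimately show ?thesis by linarith
  qed
  have "\<bar>(\<integral>x. f (0 + x) \<partial>m (N - 1)) - (\<integral>x. f (0 + x) \<partial>g (N - 1))\<bar> \<le> real (Suc (N - 1)) * ?c"
    by (rule convolution_powers_bound[OF pm pg _ _ mSuc gSuc _ bdd step]) (auto simp: m_def g_def)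
  moreover have "(\<integral>x. f x \<partial>m (N - 1)) = expectation (\<lambda>\<omega>. f ((\<Sum>k<N. X k \<omega>) / sqrt (real N)))"
    unfolding m_def using N
    by (subst integral_distr) (auto simp: a_def sum_divide_distrib)
  moreover have "g (N - 1) = std_normal_distribution"
    using N by (simp add: g_def a_def)
  moreover have "real (Suc (N - 1)) * ?c = K / 6 * ((\<integral>x. \<bar>x\<bar> ^ 3 \<partial>law) + 2 * sqrt (2 / pi)) / sqrt (real N)"
  proof -
    have "real (Suc (N - 1)) * ?c = (a\<^sup>2 * N) * a * (K / 6 * ((\<integral>x. \<bar>x\<bar> ^ 3 \<partial>law) + 2 * sqrt (2 / pi)))"
      unfolding int_m int_g using N
      by (simp only: power2_eq_square power3_eq_cube) (simp add: algebra_simps)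
    then show ?thesis unfolding a(2) by (simp add: a_def)
  qed
  ultimately show ?thesis by simp
qed

lemma gauss_integral_eq: "gauss_integral \<psi> = (\<integral>x. \<psi> x \<partial>std_normal_distribution)"
  if [measurable]: "\<psi> \<in> borel_measurable borel"
  unfolding gauss_integral_def
  by (subst integral_density) (auto simp: std_normal_density_def normal_density_nonneg mult.commute)

text \<open>With only second moments and a merely continuous \<open>f\<close> the Taylor argument is
  out of reach; the classical theorem supplies weak convergence, which is then tested against
  bounded continuous functions.\<close>

lemma (in prob_space) central_limit_bounded_continuous:
  fixes X :: "nat \<Rightarrow> 'a \<Rightarrow> real" and f :: "real \<Rightarrow> real"
  assumes indep: "indep_vars (\<lambda>_. borel) X UNIV"
    and law: "\<And>k. distr M borel (X k) = law"
    and mean: "(\<integral>x. x \<partial>law) = 0" and var: "(\<integral>x. x\<^sup>2 \<partial>law) = 1"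
    and int2: "integrable law (\<lambda>x. x\<^sup>2)"
    and cont: "continuous_on UNIV f" and bdd: "\<And>w. \<bar>f w\<bar> \<le> B"
  shows "(\<lambda>N. expectation (\<lambda>\<omega>. f ((\<Sum>k<N. X k \<omega>) / sqrt (real N))))
    \<longlonglongrightarrow> (\<integral>x. f x \<partial>std_normal_distribution)"
proof -
  have X[measurable]: "X k \<in> borel_measurable M" for k
    using indep unfolding indep_vars_def2 by simp
  have [measurable]: "f \<in> borel_measurable borel"
    using cont by (rule borel_measurable_continuous_onI)
  have "expectation (X k) = (\<integral>x. x \<partial>distr M borel (X k))" for k
    by (subst integral_distr) auto
  then have EX: "expectation (X k) = 0" for k
    unfolding law by (simp only: mean)
  have "expectation (\<lambda>\<omega>. (X k \<omega>)\<^sup>2) = (\<integral>x. x\<^sup>2 \<partial>distr M borel (X k))" for k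
    by (subst integral_distr) auto
  then have EX2: "expectation (\<lambda>\<omega>. (X k \<omega>)\<^sup>2) = 1" for k
    unfolding law by (simp only: var)
  have int: "integrable M (\<lambda>\<omega>. (X k \<omega>)\<^sup>2)" for k
    using int2 integrable_distr_eq[of "X k" M borel "\<lambda>x. x\<^sup>2"] by (simp add: law)
  \<comment> \<open>The factor \<open>1\<^sup>2\<close> is the common variance of the summands, in
    the form of the classical theorem.\<close>
  let ?m = "\<lambda>n. distr M borel (\<lambda>\<omega>. (\<Sum>k<n. X k \<omega>) / sqrt (real n * 1\<^sup>2))"
  have "weak_conv_m ?m std_normal_distribution"
    by (rule central_limit_theorem_zero_mean[OF indep EX _ int _ law]) (use EX EX2 in auto)
  moreover have "real_distribution (?m n)" for n
    by (rule real_distribution_distr) auto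
  moreover have "isCont f w" for w
    using cont by (simp add: continuous_on_eq_continuous_at)
  ultimately have "(\<lambda>n. \<integral>x. f x \<partial>?m n) \<longlonglongrightarrow> (\<integral>x. f x \<partial>std_normal_distribution)"
    using bdd real_dist_normal_dist
    by (intro weak_conv_imp_integral_bdd_continuous_conv[where B = B]) auto
  then show ?thesis by (simp add: integral_distr)
qed

section \<open>Sampling cadlag paths at random times\<close>

lemma trajectory_in_path_space: "trajectory X \<omega> \<in> space path_space"
  by (simp add: trajectory_def path_space_def space_PiM)

lemma trajectory_eq: "0 \<le> s \<Longrightarrow> trajectory X \<omega> s = X s \<omega>"
  by (simp add: trajectory_def)

lemma measurable_path_component: "0 \<le> s \<Longrightarrow> (\<lambda>m. m s) \<in> borel_measurable path_space"
  unfolding path_space_def by (rule measurable_component_singleton) simp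

lemma measurable_trajectory:
  assumes "\<And>s. 0 \<le> s \<Longrightarrow> X s \<in> borel_measurable R"
  shows "trajectory X \<in> measurable R path_space"
  unfolding path_space_def trajectory_def by (rule measurable_restrict) (use assms in auto)

text \<open>Evaluation at a random time is not measurable on \<open>path_space\<close>. It is replaced by the limit along
  grid points to the right of the time, which is measurable and agrees with it on cadlag paths.\<close>

definition grid_above :: "nat \<Rightarrow> real \<Rightarrow> real" where
  "grid_above n s = (real_of_int \<lfloor>s * real (Suc n)\<rfloor> + 1) / real (Suc n)"

definition eval_at :: "(real \<Rightarrow> 'a::t2_space) \<Rightarrow> real \<Rightarrow> 'a" where
  "eval_at m s = lim (\<lambda>n. m (grid_above n s))"

lemma LIMSEQ_one_over_Suc: "(\<lambda>n. 1 / real (Suc n)) \<longlonglongrightarrow> 0"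
  by (rule LIMSEQ_Suc[OF lim_1_over_n])

text \<open>Floor plus one, unlike the ceiling, stays strictly above \<open>s\<close> even when
  \<open>s\<close> lies on the grid. The grid points therefore converge to \<open>s\<close> within
  \<open>at_right s\<close>, where right-continuity is stated.\<close>

lemma grid_above_bounds:
  "s < grid_above n s" "grid_above n s \<le> s + 1 / real (Suc n)"
proof -
  have "s = s * real (Suc n) / real (Suc n)" by simp
  also have "\<dots> < grid_above n s"
    unfolding grid_above_def by (intro divide_strict_right_mono) linarith+
  finally show "s < grid_above n s" .
  have "grid_above n s \<le> (s * real (Suc n) + 1) / real (Suc n)"
    unfolding grid_above_def by (intro divide_right_mono) linarith+
  also have "\<dots> = s + 1 / real (Suc n)" by (simp add: field_simps)
  finally show "grid_above n s \<le> s + 1 / real (Suc n)" .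
qed

lemma filterlim_grid_above: "filterlim (\<lambda>n. grid_above n s) (at_right s) sequentially"
proof (rule tendsto_imp_filterlim_at_right)
  have upper: "(\<lambda>n. s + 1 / real (Suc n)) \<longlonglongrightarrow> s"
    using tendsto_add[OF tendsto_const[of s] LIMSEQ_one_over_Suc] by simp
  show "(\<lambda>n. grid_above n s) \<longlonglongrightarrow> s"
    by (rule tendsto_sandwich[OF _ _ tendsto_const upper])
       (intro always_eventually allI less_imp_le[OF grid_above_bounds(1)] grid_above_bounds(2))+
qed (auto intro!: always_eventually grid_above_bounds)

lemma eval_at_eq:
  fixes m :: "real \<Rightarrow> 'a::t2_space"
  assumes "(m \<longlongrightarrow> m s) (at_right s)"
  shows "eval_at m s = m s"
  unfolding eval_at_def using filterlim_compose[OF assms filterlim_grid_above] by (rule limI)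

lemma eval_at_trajectory:
  fixes X :: "real \<Rightarrow> 'w \<Rightarrow> 'a::t2_space"
  assumes "cadlag (\<lambda>t. X t \<omega>)" "0 \<le> s"
  shows "eval_at (trajectory X \<omega>) s = X s \<omega>"
proof -
  have "trajectory X \<omega> (grid_above n s) = X (grid_above n s) \<omega>" for n
    using grid_above_bounds(1)[of s n] assms(2) by (simp add: trajectory_eq)
  then have "eval_at (trajectory X \<omega>) s = eval_at (\<lambda>t. X t \<omega>) s"
    by (simp add: eval_at_def)
  also have "\<dots> = X s \<omega>"
    by (rule eval_at_eq) (use assms in \<open>auto simp: cadlag_def\<close>)
  finally show ?thesis .
qed

text \<open>The rounded time takes countably many values, so each approximant is a countable
  patchwork of the measurable \<open>X s\<close>; their \<open>lim\<close> is measurable whether or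
  not they converge. As no path regularity is assumed, the coordinate process on
  \<open>path_space\<close> may be taken for \<open>X\<close>.\<close>

lemma measurable_eval_at:
  fixes X :: "real \<Rightarrow> 'w \<Rightarrow> 'a::{banach, second_countable_topology}"
  assumes X: "\<And>s. 0 \<le> s \<Longrightarrow> X s \<in> borel_measurable R"
    and \<tau>[measurable]: "\<tau> \<in> borel_measurable R" and nonneg: "\<And>\<omega>. \<omega> \<in> space R \<Longrightarrow> 0 \<le> \<tau> \<omega>"
  shows "(\<lambda>\<omega>. eval_at (\<lambda>s. X s \<omega>) (\<tau> \<omega>)) \<in> borel_measurable R"
proof -
  have "(\<lambda>\<omega>. X (grid_above n (\<tau> \<omega>)) \<omega>) \<in> borel_measurable R" for n
  proof -
    \<comment> \<open>The countable index ranges over all integers, including those with negative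
      grid points; \<open>max 0\<close> keeps to times where \<open>X\<close> is known to be
      measurable and is inert for \<open>\<tau> \<ge> 0\<close>.\<close>
    have "(\<lambda>\<omega>. X (max 0 ((real_of_int \<lfloor>\<tau> \<omega> * real (Suc n)\<rfloor> + 1) / real (Suc n))) \<omega>) \<in> borel_measurable R"
      by (rule measurable_compose_countable
            [where f = "\<lambda>i \<omega>. X (max 0 ((real_of_int i + 1) / real (Suc n))) \<omega>"])
         (auto intro!: X)
    moreover have "max 0 ((real_of_int \<lfloor>\<tau> \<omega> * real (Suc n)\<rfloor> + 1) / real (Suc n)) = grid_above n (\<tau> \<omega>)"
      if "\<omega> \<in> space R" for \<omega>
      using nonneg[OF that] grid_above_bounds(1)[of "\<tau> \<omega>" n] unfolding grid_above_def by simp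
    ultimately show ?thesis
      by (subst (asm) measurable_cong[where g = "\<lambda>\<omega>. X (grid_above n (\<tau> \<omega>)) \<omega>"]) auto
  qed
  then show ?thesis unfolding eval_at_def by (rule borel_measurable_lim_metric)
qed

lemma measurable_cadlag_at:
  fixes X :: "real \<Rightarrow> 'w \<Rightarrow> 'a::{banach, second_countable_topology}"
  assumes X: "\<And>s. 0 \<le> s \<Longrightarrow> X s \<in> borel_measurable R"
    and cadlag: "\<And>\<omega>. \<omega> \<in> space R \<Longrightarrow> cadlag (\<lambda>t. X t \<omega>)"
    and \<tau>: "\<tau> \<in> borel_measurable R" and nonneg: "\<And>\<omega>. \<omega> \<in> space R \<Longrightarrow> 0 \<le> \<tau> \<omega>"
  shows "(\<lambda>\<omega>. X (\<tau> \<omega>) \<omega>) \<in> borel_measurable R"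
proof -
  have "eval_at (\<lambda>s. X s \<omega>) (\<tau> \<omega>) = X (\<tau> \<omega>) \<omega>" if "\<omega> \<in> space R" for \<omega>
    using cadlag[OF that] nonneg[OF that] by (intro eval_at_eq) (auto simp: cadlag_def)
  then show ?thesis
    using measurable_eval_at[OF X \<tau> nonneg]
    by (subst measurable_cong[where g = "\<lambda>\<omega>. eval_at (\<lambda>s. X s \<omega>) (\<tau> \<omega>)"]) auto
qed

section \<open>Measurability of the inverse, the undershooting and the overshooting\<close>

lemma inverse_process_nonneg: "0 \<le> inverse_process \<sigma> t \<omega>"
  unfolding inverse_process_def by (auto intro!: cInf_greatest)

text \<open>Monotonicity reduces uncountably many times to countably many: an exceedance before
  \<open>a\<close> persists to a rational time still before \<open>a\<close>, and an exceedance at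
  any time persists to an integer time. The second disjunct is the default value 0 on paths that
  never exceed \<open>t\<close>.\<close>

lemma inverse_process_less_iff:
  assumes mono: "mono_on {0..} (\<lambda>s. \<sigma> s \<omega>)"
  shows "inverse_process \<sigma> t \<omega> < a \<longleftrightarrow>
    (\<exists>q\<in>\<rat> \<inter> {0..<a}. t < \<sigma> q \<omega>) \<or> \<not> (\<exists>n::nat. t < \<sigma> (real n) \<omega>) \<and> 0 < a"
proof -
  have ex: "(\<exists>s\<ge>0. t < \<sigma> s \<omega>) \<longleftrightarrow> (\<exists>n::nat. t < \<sigma> (real n) \<omega>)"
  proof
    assume "\<exists>s\<ge>0. t < \<sigma> s \<omega>"
    then obtain s where s: "0 \<le> s" "t < \<sigma> s \<omega>" by auto
    obtain n :: nat where "s \<le> real n" using real_arch_simple by blast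
    then have "\<sigma> s \<omega> \<le> \<sigma> (real n) \<omega>" using s mono by (auto simp: mono_on_def)
    then show "\<exists>n::nat. t < \<sigma> (real n) \<omega>" using s by (intro exI[of _ n]) auto
  qed (use of_nat_0_le_iff in blast)
  show ?thesis
  proof (cases "\<exists>s\<ge>0. t < \<sigma> s \<omega>")
    case True
    then have ne: "{s. 0 \<le> s \<and> t < \<sigma> s \<omega>} \<noteq> {}" by auto
    have bdd: "bdd_below {s. 0 \<le> s \<and> t < \<sigma> s \<omega>}" by (rule bdd_belowI[of _ 0]) auto
    have "inverse_process \<sigma> t \<omega> < a \<longleftrightarrow> (\<exists>s. 0 \<le> s \<and> t < \<sigma> s \<omega> \<and> s < a)"
      using True cInf_less_iff[OF ne bdd] by (auto simp: inverse_process_def)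
    also have "\<dots> \<longleftrightarrow> (\<exists>q\<in>\<rat> \<inter> {0..<a}. t < \<sigma> q \<omega>)"
    proof
      assume "\<exists>s. 0 \<le> s \<and> t < \<sigma> s \<omega> \<and> s < a"
      then obtain s where s: "0 \<le> s" "t < \<sigma> s \<omega>" "s < a" by auto
      obtain q where q: "q \<in> \<rat>" "s < q" "q < a" using Rats_dense_in_real[OF s(3)] by auto
      then have "\<sigma> s \<omega> \<le> \<sigma> q \<omega>" using s mono by (auto simp: mono_on_def)
      then show "\<exists>q\<in>\<rat> \<inter> {0..<a}. t < \<sigma> q \<omega>" using s q by (intro bexI[of _ q]) auto
    qed auto
    finally show ?thesis using True ex by auto
  next
    case False
    then have "inverse_process \<sigma> t \<omega> = 0" unfolding inverse_process_def by (rule if_not_P)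
    then show ?thesis using False ex by auto
  qed
qed

lemma measurable_inverse_process:
  assumes [measurable]: "\<And>s. 0 \<le> s \<Longrightarrow> \<sigma> s \<in> borel_measurable R"
    and mono: "\<And>\<omega>. \<omega> \<in> space R \<Longrightarrow> mono_on {0..} (\<lambda>s. \<sigma> s \<omega>)"
  shows "inverse_process \<sigma> t \<in> borel_measurable R"
proof (rule borel_measurableI_less)
  fix a
  have "{\<omega> \<in> space R. inverse_process \<sigma> t \<omega> < a} =
      (\<Union>q\<in>\<rat> \<inter> {0..<a}. {\<omega> \<in> space R. t < \<sigma> q \<omega>}) \<union>
      (if 0 < a then space R - (\<Union>n::nat. {\<omega> \<in> space R. t < \<sigma> (real n) \<omega>}) else {})"
    using inverse_process_less_iff[of \<sigma>, OF mono] by auto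
  also have "\<dots> \<in> sets R"
    by (intro sets.Un sets.countable_UN') (auto simp: countable_rat)
  finally show "{\<omega> \<in> space R. inverse_process \<sigma> t \<omega> < a} \<in> sets R" .
qed

text \<open>A left limit written as a limit along a sequence inherits measurability from the values.
  \<open>max 0\<close> keeps the times nonnegative, and for \<open>l = 0\<close> it makes the
  sequence constant, in accord with the convention at 0.\<close>

lemma left_value_LIMSEQ:
  assumes cadlag: "cadlag (\<lambda>s. \<sigma> s \<omega>)" and "0 \<le> l"
  shows "(\<lambda>n. \<sigma> (max 0 (l - 1 / real (Suc n))) \<omega>) \<longlonglongrightarrow> left_value \<sigma> l \<omega>"
proof (cases "l = 0")
  case True
  have "max 0 (l - 1 / real (Suc n)) = 0" for n using True by simp
  then show ?thesis using True by (simp add: left_value_def)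
next
  case False
  with assms have l: "0 < l" by simp
  then obtain L where L: "((\<lambda>s. \<sigma> s \<omega>) \<longlongrightarrow> L) (at_left l)" using cadlag by (auto simp: cadlag_def)
  then have eq: "left_value \<sigma> l \<omega> = L"
    using l by (simp add: left_value_def tendsto_Lim)
  have "(\<lambda>n. max 0 (l - 1 / real (Suc n))) \<longlonglongrightarrow> max 0 (l - 0)"
    by (rule tendsto_max[OF tendsto_const tendsto_diff[OF tendsto_const LIMSEQ_one_over_Suc]])
  then have "filterlim (\<lambda>n. max 0 (l - 1 / real (Suc n))) (at_left l) sequentially"
    using l by (intro tendsto_imp_filterlim_at_left) auto
  from filterlim_compose[OF L this] show ?thesis unfolding eq .
qed

text \<open>Measurability holds relative to any \<open>R\<close> that makes all
  \<open>\<sigma> s\<close> measurable. Taking for \<open>R\<close> the sigma-algebra generated by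
  the trajectory of \<open>\<sigma>\<close> exhibits \<open>T t\<close> as a functional of
  \<open>\<sigma>\<close>, which is what independence from \<open>M\<close> requires.\<close>

lemma time_change_measurable_nonneg:
  assumes T: "T \<in> {inverse_process \<sigma>, undershooting \<sigma>, overshooting \<sigma>}"
    and meas: "\<And>s. 0 \<le> s \<Longrightarrow> \<sigma> s \<in> borel_measurable R"
    and cadlag: "\<And>\<omega>. \<omega> \<in> space R \<Longrightarrow> cadlag (\<lambda>s. \<sigma> s \<omega>)"
    and mono: "\<And>\<omega>. \<omega> \<in> space R \<Longrightarrow> mono_on {0..} (\<lambda>s. \<sigma> s \<omega>)"
    and nonneg: "\<And>\<omega>. \<omega> \<in> space R \<Longrightarrow> 0 \<le> \<sigma> 0 \<omega>"
  shows "T t \<in> borel_measurable R" "\<And>\<omega>. \<omega> \<in> space R \<Longrightarrow> 0 \<le> T t \<omega>"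
proof -
  have \<sigma>0: "0 \<le> \<sigma> s \<omega>" if "\<omega> \<in> space R" "0 \<le> s" for s \<omega>
    using nonneg[OF that(1)] mono_onD[OF mono[OF that(1)], of 0 s] that by auto
  have inv[measurable]: "inverse_process \<sigma> t \<in> borel_measurable R"
    by (rule measurable_inverse_process[OF meas mono])
  have lim: "(\<lambda>n. \<sigma> (max 0 (inverse_process \<sigma> t \<omega> - 1 / real (Suc n))) \<omega>) \<longlonglongrightarrow> undershooting \<sigma> t \<omega>"
    if "\<omega> \<in> space R" for \<omega>
    unfolding undershooting_def by (rule left_value_LIMSEQ[of \<sigma>, OF cadlag[OF that] inverse_process_nonneg])
  have over: "overshooting \<sigma> t \<in> borel_measurable R"
    unfolding overshooting_def[abs_def]
    by (rule measurable_cadlag_at[OF meas cadlag inv inverse_process_nonneg])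
  have under: "undershooting \<sigma> t \<in> borel_measurable R"
    by (rule borel_measurable_LIMSEQ_real[OF lim])
       (auto intro!: measurable_cadlag_at[OF meas cadlag])
  show "T t \<in> borel_measurable R" using T inv over under by auto
  show "0 \<le> T t \<omega>" if "\<omega> \<in> space R" for \<omega>
  proof -
    have "0 \<le> undershooting \<sigma> t \<omega>"
      by (rule LIMSEQ_le_const[OF lim[OF that]]) (auto intro!: \<sigma>0 that)
    moreover have "0 \<le> overshooting \<sigma> t \<omega>"
      unfolding overshooting_def by (intro \<sigma>0 that inverse_process_nonneg)
    ultimately show ?thesis using T inverse_process_nonneg by auto
  qed
qed

section \<open>Moments at an independent random time\<close>

text \<open>Each event of \<open>\<tau>\<close> is a preimage under \<open>trajectory Y\<close>,
  hence independent of every event of \<open>trajectory X\<close>. The joint law and the product law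
  therefore agree on rectangles, which determines them.\<close>

lemma (in prob_space) distr_pair_indep_processes:
  fixes \<tau> :: "'a \<Rightarrow> 'd::topological_space"
  assumes indep: "indep_processes M X Y"
    and X: "\<And>s. 0 \<le> s \<Longrightarrow> X s \<in> borel_measurable M"
    and Y: "\<And>s. 0 \<le> s \<Longrightarrow> Y s \<in> borel_measurable M"
    and \<tau>: "\<tau> \<in> borel_measurable (vimage_algebra (space M) (trajectory Y) path_space)"
  shows "\<tau> \<in> borel_measurable M"
    and "distr M path_space (trajectory X) \<Otimes>\<^sub>M distr M borel \<tau>
      = distr M (path_space \<Otimes>\<^sub>M borel) (\<lambda>\<omega>. (trajectory X \<omega>, \<tau> \<omega>))"
proof -
  have tX[measurable]: "trajectory X \<in> measurable M path_space"
    and tY[measurable]: "trajectory Y \<in> measurable M path_space"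
    using X Y by (auto intro: measurable_trajectory)
  have fn: "trajectory Y \<in> space M \<rightarrow> space path_space"
    by (auto intro: trajectory_in_path_space)
  have gen: "\<exists>C\<in>sets path_space. \<tau> -` B \<inter> space M = trajectory Y -` C \<inter> space M" if "B \<in> sets borel" for B
  proof -
    have "\<tau> -` B \<inter> space M \<in> {trajectory Y -` C \<inter> space M |C. C \<in> sets path_space}"
      using measurable_sets[OF \<tau> that] by (simp only: sets_vimage_algebra2[OF fn] space_vimage_algebra)
    then show ?thesis by (elim CollectE exE conjE) (rule bexI)
  qed
  show \<tau>M[measurable]: "\<tau> \<in> borel_measurable M"
  proof (rule measurableI)
    fix B :: "'d set" assume "B \<in> sets borel"
    then obtain C where "C \<in> sets path_space" "\<tau> -` B \<inter> space M = trajectory Y -` C \<inter> space M"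
      using gen by blast
    then show "\<tau> -` B \<inter> space M \<in> sets M" using measurable_sets[OF tY] by auto
  qed simp
  interpret X: prob_space "distr M path_space (trajectory X)" by (rule prob_space_distr) fact
  interpret T: prob_space "distr M borel \<tau>" by (rule prob_space_distr) fact
  show "distr M path_space (trajectory X) \<Otimes>\<^sub>M distr M borel \<tau>
      = distr M (path_space \<Otimes>\<^sub>M borel) (\<lambda>\<omega>. (trajectory X \<omega>, \<tau> \<omega>))"
  proof (rule pair_measure_eqI)
    fix A B assume AB: "A \<in> sets (distr M path_space (trajectory X))" "B \<in> sets (distr M borel \<tau>)"
    then obtain C where C: "C \<in> sets path_space" "\<tau> -` B \<inter> space M = trajectory Y -` C \<inter> space M"
      using gen[of B] by auto
    have "emeasure (distr M (path_space \<Otimes>\<^sub>M borel) (\<lambda>\<omega>. (trajectory X \<omega>, \<tau> \<omega>))) (A \<times> B)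
        = emeasure M ((\<lambda>\<omega>. (trajectory X \<omega>, \<tau> \<omega>)) -` (A \<times> B) \<inter> space M)"
      by (rule emeasure_distr) (use AB in \<open>auto intro: pair_measureI\<close>)
    also have "(\<lambda>\<omega>. (trajectory X \<omega>, \<tau> \<omega>)) -` (A \<times> B) \<inter> space M
        = (trajectory X -` A \<inter> space M) \<inter> (trajectory Y -` C \<inter> space M)"
      using C(2) by auto
    also have "emeasure M \<dots> = emeasure M (trajectory X -` A \<inter> space M) * emeasure M (trajectory Y -` C \<inter> space M)"
    proof -
      have "prob ((trajectory X -` A \<inter> space M) \<inter> (trajectory Y -` C \<inter> space M))
          = prob (trajectory X -` A \<inter> space M) * prob (trajectory Y -` C \<inter> space M)"
        using AB(1) C(1) by (intro indep_setD[OF indep[unfolded indep_processes_def]]) (simp, blast)+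
      then show ?thesis by (simp add: emeasure_eq_measure ennreal_mult)
    qed
    also have "\<dots> = emeasure (distr M path_space (trajectory X)) A * emeasure (distr M borel \<tau>) B"
      using AB C(2) by (simp add: emeasure_distr)
    finally show "emeasure (distr M path_space (trajectory X)) A * emeasure (distr M borel \<tau>) B =
        emeasure (distr M (path_space \<Otimes>\<^sub>M borel) (\<lambda>\<omega>. (trajectory X \<omega>, \<tau> \<omega>))) (A \<times> B)" by simp
  qed ((rule X.sigma_finite_measure_axioms T.sigma_finite_measure_axioms)+,
       simp cong: sets_pair_measure_cong)
qed

text \<open>Under the product law Tonelli's theorem allows the time to be frozen and the path to be
  integrated out first.\<close>

lemma (in prob_space) nn_integral_indep_time:
  fixes X :: "real \<Rightarrow> 'a \<Rightarrow> 'b::{banach, second_countable_topology}" and Y :: "real \<Rightarrow> 'a \<Rightarrow> 'c::topological_space"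
  assumes indep: "indep_processes M X Y"
    and X: "\<And>s. 0 \<le> s \<Longrightarrow> X s \<in> borel_measurable M"
    and Y: "\<And>s. 0 \<le> s \<Longrightarrow> Y s \<in> borel_measurable M"
    and cadlag: "\<And>\<omega>. \<omega> \<in> space M \<Longrightarrow> cadlag (\<lambda>s. X s \<omega>)"
    and \<tau>: "\<tau> \<in> borel_measurable (vimage_algebra (space M) (trajectory Y) path_space)"
    and nonneg: "\<And>\<omega>. \<omega> \<in> space M \<Longrightarrow> 0 \<le> \<tau> \<omega>"
    and f[measurable]: "f \<in> borel_measurable borel"
  shows "(\<integral>\<^sup>+\<omega>. f (X (\<tau> \<omega>) \<omega>) \<partial>M)
    = (\<integral>\<^sup>+w\<in>{0..}. (\<integral>\<^sup>+\<omega>. f (X w \<omega>) \<partial>M) \<partial>distr M borel \<tau>)"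
proof -
  note joint = distr_pair_indep_processes[OF indep X Y \<tau>]
  note [measurable] = joint(1)
  have tX[measurable]: "trajectory X \<in> measurable M path_space"
    using X by (rule measurable_trajectory)
  interpret X: prob_space "distr M path_space (trajectory X)" by (rule prob_space_distr) fact
  interpret T: prob_space "distr M borel \<tau>" by (rule prob_space_distr[OF joint(1)])
  interpret pair_sigma_finite "distr M path_space (trajectory X)" "distr M borel \<tau>" ..
  \<comment> \<open>Tonelli needs joint measurability in path and time, which \<open>eval_at\<close>
    has; \<open>max 0\<close> supplies the nonnegative time that \<open>measurable_eval_at\<close>
    asks for.\<close>
  have ev: "(\<lambda>p. eval_at (fst p) (max 0 (snd p))) \<in> borel_measurable ((path_space :: (real \<Rightarrow> 'b) measure) \<Otimes>\<^sub>M (borel :: real measure))"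
    by (rule measurable_eval_at[where X = "\<lambda>s p. fst p s"])
       (auto intro!: measurable_compose[OF measurable_fst measurable_path_component])
  let ?F = "\<lambda>p. f (eval_at (fst p) (max 0 (snd p)))"
  have F[measurable]: "?F \<in> borel_measurable (path_space \<Otimes>\<^sub>M (borel :: real measure))"
    by (rule measurable_compose[OF ev f])
  have "(\<integral>\<^sup>+\<omega>. f (X (\<tau> \<omega>) \<omega>) \<partial>M) = (\<integral>\<^sup>+\<omega>. ?F (trajectory X \<omega>, \<tau> \<omega>) \<partial>M)"
    using nonneg by (intro nn_integral_cong) (simp add: eval_at_trajectory[of X, OF cadlag])
  also have "\<dots> = (\<integral>\<^sup>+p. ?F p \<partial>distr M (path_space \<Otimes>\<^sub>M borel) (\<lambda>\<omega>. (trajectory X \<omega>, \<tau> \<omega>)))"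
    by (rule nn_integral_distr[symmetric]) auto
  also have "\<dots> = (\<integral>\<^sup>+w. \<integral>\<^sup>+m. ?F (m, w) \<partial>distr M path_space (trajectory X) \<partial>distr M borel \<tau>)"
  proof -
    have "(\<integral>\<^sup>+w. \<integral>\<^sup>+m. ?F (m, w) \<partial>distr M path_space (trajectory X) \<partial>distr M borel \<tau>)
      = (\<integral>\<^sup>+p. ?F p \<partial>(distr M path_space (trajectory X) \<Otimes>\<^sub>M distr M borel \<tau>))"
      by (rule nn_integral_snd[of ?F]) (simp add: F cong: measurable_cong_sets sets_pair_measure_cong)
    then show ?thesis by (simp only: joint(2))
  qed
  also have "\<dots> = (\<integral>\<^sup>+w. \<integral>\<^sup>+\<omega>. ?F (trajectory X \<omega>, w) \<partial>M \<partial>distr M borel \<tau>)"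
    by (intro nn_integral_cong nn_integral_distr[OF tX]) (use measurable_Pair1[OF F] in simp)
  also have "\<dots> = (\<integral>\<^sup>+w\<in>{0..}. (\<integral>\<^sup>+\<omega>. f (X w \<omega>) \<partial>M) \<partial>distr M borel \<tau>)"
  proof (rule nn_integral_cong_AE)
    \<comment> \<open>The law of \<open>\<tau>\<close> is carried by \<open>{0..}\<close>; there the
      clipped time is \<open>w\<close> itself and \<open>eval_at\<close> returns the value of the
      cadlag path.\<close>
    have "AE w in distr M borel \<tau>. 0 \<le> w"
      using nonneg by (subst AE_distr_iff) auto
    then show "AE w in distr M borel \<tau>. (\<integral>\<^sup>+\<omega>. ?F (trajectory X \<omega>, w) \<partial>M)
        = (\<integral>\<^sup>+\<omega>. f (X w \<omega>) \<partial>M) * indicator {0..} w"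
    proof eventually_elim
      case (elim w)
      then have "(\<integral>\<^sup>+\<omega>. ?F (trajectory X \<omega>, w) \<partial>M) = (\<integral>\<^sup>+\<omega>. f (X w \<omega>) \<partial>M)"
        by (intro nn_integral_cong) (simp add: eval_at_trajectory[of X, OF cadlag])
      then show ?case using elim by simp
    qed
  qed
  finally show ?thesis .
qed

section \<open>From tail integrals to moments\<close>

lemma nn_integral_power_tail:
  assumes q: "0 < q" and c: "0 \<le> c"
  shows "(\<integral>\<^sup>+s\<in>{1..}. ennreal (s powr (q - 1)) * indicator {..<c} s \<partial>lborel) = ennreal ((max 1 c powr q - 1) / q)"
proof -
  have "(\<integral>\<^sup>+s\<in>{1..}. ennreal (s powr (q - 1)) * indicator {..<c} s \<partial>lborel)
      = (\<integral>\<^sup>+s. ennreal (s powr (q - 1)) * indicator {1..max 1 c} s \<partial>lborel)"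
  proof (rule nn_integral_cong_AE)
    show "AE s in lborel. ennreal (s powr (q - 1)) * indicator {..<c} s * indicator {1..} s
        = ennreal (s powr (q - 1)) * indicator {1..max 1 c} s"
      \<comment> \<open>The two integrands can differ only at \<open>c\<close>, because
        \<open>{..<c}\<close> is open on the right, and at 1, because \<open>{1..max 1 c}\<close> is
        \<open>{1}\<close> for \<open>c \<le> 1\<close>.\<close>
      using AE_lborel_singleton[of c] AE_lborel_singleton[of 1]
      by eventually_elim (auto split: split_indicator)
  qed
  also have "\<dots> = ennreal (max 1 c powr q / q - 1 powr q / q)"
    by (rule nn_integral_FTC_Icc[where F = "\<lambda>s. s powr q / q"])
       (use q in \<open>auto intro!: derivative_eq_intros\<close>)
  finally show ?thesis by (simp add: diff_divide_distrib)
qed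

text \<open>Layer cake formula truncated at 1: for each outcome, integrating the power over
  \<open>s\<close> from 1 up to the norm produces the integrand on the right, and Tonelli exchanges
  the order. \<open>max 1\<close> makes it vanish for norms below 1.\<close>

lemma (in prob_space) nn_integral_tail:
  fixes X :: "'a \<Rightarrow> 'b::{real_normed_vector, second_countable_topology}"
  assumes [measurable]: "X \<in> borel_measurable M" and q: "0 < q"
  shows "(\<integral>\<^sup>+s\<in>{1..}. ennreal (s powr (q - 1)) * emeasure M {\<omega> \<in> space M. norm (X \<omega>) > s} \<partial>lborel)
    = (\<integral>\<^sup>+\<omega>. ennreal ((max 1 (norm (X \<omega>)) powr q - 1) / q) \<partial>M)"
proof -
  interpret pair_sigma_finite M lborel ..
  have "(\<integral>\<^sup>+\<omega>. ennreal ((max 1 (norm (X \<omega>)) powr q - 1) / q) \<partial>M)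
    = (\<integral>\<^sup>+\<omega>. \<integral>\<^sup>+s. ennreal (s powr (q - 1)) * indicator {..<norm (X \<omega>)} s * indicator {1..} s \<partial>lborel \<partial>M)"
    by (simp add: nn_integral_power_tail[OF q])
  also have "\<dots> = (\<integral>\<^sup>+\<omega>. \<integral>\<^sup>+s. ennreal (s powr (q - 1)) * indicator {1..} s * indicator {\<omega> \<in> space M. norm (X \<omega>) > s} \<omega> \<partial>lborel \<partial>M)"
    by (intro nn_integral_cong) (auto split: split_indicator)
  also have "\<dots> = (\<integral>\<^sup>+s. \<integral>\<^sup>+\<omega>. ennreal (s powr (q - 1)) * indicator {1..} s * indicator {\<omega> \<in> space M. norm (X \<omega>) > s} \<omega> \<partial>M \<partial>lborel)"
    by (rule Fubini'[symmetric]) measurable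
  also have "\<dots> = (\<integral>\<^sup>+s\<in>{1..}. ennreal (s powr (q - 1)) * emeasure M {\<omega> \<in> space M. norm (X \<omega>) > s} \<partial>lborel)"
    by (intro nn_integral_cong) (simp add: nn_integral_cmult mult_ac)
  finally show ?thesis by simp
qed

text \<open>The tail condition integrates over the law of \<open>T t\<close>; independence turns its
  inner expectations at fixed times into one expectation at the random time.\<close>

lemma (in prob_space) integrable_moment_indep_time:
  fixes X :: "real \<Rightarrow> 'a \<Rightarrow> 'b::euclidean_space" and Y :: "real \<Rightarrow> 'a \<Rightarrow> 'c::topological_space"
  assumes indep: "indep_processes M X Y"
    and X: "\<And>s. 0 \<le> s \<Longrightarrow> X s \<in> borel_measurable M"
    and Y: "\<And>s. 0 \<le> s \<Longrightarrow> Y s \<in> borel_measurable M"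
    and cadlag: "\<And>\<omega>. \<omega> \<in> space M \<Longrightarrow> cadlag (\<lambda>s. X s \<omega>)"
    and T: "T t \<in> borel_measurable (vimage_algebra (space M) (trajectory Y) path_space)"
    and nonneg: "\<And>\<omega>. \<omega> \<in> space M \<Longrightarrow> 0 \<le> T t \<omega>"
    and q: "0 < q" and tail: "tail_condition M X T q t"
  shows "integrable M (\<lambda>\<omega>. norm (X (T t \<omega>) \<omega>) powr q)"
proof -
  have [measurable]: "T t \<in> borel_measurable M"
    by (rule distr_pair_indep_processes(1)[OF indep X Y T])
  have [measurable]: "(\<lambda>\<omega>. X (T t \<omega>) \<omega>) \<in> borel_measurable M"
    by (rule measurable_cadlag_at[OF X cadlag _ nonneg]) auto
  let ?f = "\<lambda>m. (max 1 (norm m) powr q - 1) / q"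
  have "(\<integral>\<^sup>+\<omega>. ennreal (?f (X (T t \<omega>) \<omega>)) \<partial>M)
      = (\<integral>\<^sup>+w\<in>{0..}. (\<integral>\<^sup>+\<omega>. ennreal (?f (X w \<omega>)) \<partial>M) \<partial>distr M borel (T t))"
    by (rule nn_integral_indep_time[OF indep X Y cadlag T nonneg]) auto
  also have "\<dots> < \<infinity>"
    using tail nn_integral_tail[OF X q] unfolding tail_condition_def
    by (subst nn_integral_cong[where v = "\<lambda>w. (\<integral>\<^sup>+s\<in>{1..}. ennreal (s powr (q - 1)) *
        emeasure M {\<omega> \<in> space M. norm (X w \<omega>) > s} \<partial>lborel) * indicator {0..} w"])
       (auto split: split_indicator)
  finally have fin: "(\<integral>\<^sup>+\<omega>. ennreal (?f (X (T t \<omega>) \<omega>)) \<partial>M) < \<infinity>" .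
  have pos: "0 \<le> ?f m" for m :: 'b
    using q ge_one_powr_ge_zero[of "max 1 (norm m)" q] by simp
  have "integrable M (\<lambda>\<omega>. ?f (X (T t \<omega>) \<omega>))"
    by (rule integrableI_nonneg) (use fin pos in auto)
  then have int: "integrable M (\<lambda>\<omega>. 1 + q * ?f (X (T t \<omega>) \<omega>))"
    by (intro Bochner_Integration.integrable_add integrable_mult_right) auto
  \<comment> \<open>\<open>1 + q * ?f m\<close> is just
    \<open>max 1 (norm m) powr q\<close>.\<close>
  have "norm m powr q \<le> 1 + q * ?f m" for m :: 'b
    using q by (simp add: powr_mono2)
  then show ?thesis
    by (intro Bochner_Integration.integrable_bound[OF int]) (auto intro: order_trans[OF _ abs_ge_self])
qed

section \<open>Growth of \<open>u\<close>\<close>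

lemma locally_bounded_imp_bounded_on_compact:
  assumes "locally_bounded f" "compact K"
  shows "bounded (f ` K)"
proof -
  obtain U where U: "\<And>x. open (U x) \<and> x \<in> U x \<and> bounded (f ` U x)"
    using assms(1) unfolding locally_bounded_def by metis
  obtain F where F: "F \<subseteq> K" "finite F" "K \<subseteq> (\<Union>x\<in>F. U x)"
    using compactE_image[OF assms(2), of K U] U by blast
  have "bounded (\<Union>x\<in>F. f ` U x)" using U F(2) by (intro bounded_UN) auto
  then show ?thesis by (rule bounded_subset) (use F(3) in blast)
qed

text \<open>The growth condition controls \<open>u\<close> outside a ball and local boundedness
  inside it; the summand 1 on the right serves the inside. Outside, the maximum is attained at one
  coordinate, whose term is at most the whole sum.\<close>

lemma polynomial_growth_power_bound:
  fixes u :: "'a::euclidean_space ^ 'n::finite \<Rightarrow> real"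
  assumes bdd: "locally_bounded u" and p: "0 \<le> p" and r: "0 < r"
    and growth: "u \<in> O[at_infinity](\<lambda>z. MAX i. norm (z $ i) powr p)"
  shows "\<exists>C. \<forall>z. \<bar>u z\<bar> ^ r \<le> C * (1 + (\<Sum>i\<in>UNIV. norm (z $ i) powr (real r * p)))"
proof -
  obtain c where c: "0 < c" "\<forall>\<^sub>F z in at_infinity. norm (u z) \<le> c * norm (MAX i. norm (z $ i) powr p)"
    using growth by (elim landau_o.bigE)
  then obtain b where b: "\<And>z. b \<le> norm z \<Longrightarrow> \<bar>u z\<bar> \<le> c * \<bar>MAX i. norm (z $ i) powr p\<bar>"
    by (auto simp: eventually_at_infinity)
  obtain B where "\<forall>y\<in>u ` cball 0 b. norm y \<le> B"
    using locally_bounded_imp_bounded_on_compact[OF bdd compact_cball[of 0 b]]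
    unfolding bounded_iff by blast
  then have B: "\<bar>u z\<bar> \<le> B" if "z \<in> cball 0 b" for z
    using that by auto
  define D where "D = max c B"
  have D: "0 < D" "c \<le> D" "B \<le> D" using c by (auto simp: D_def)
  have "\<bar>u z\<bar> ^ r \<le> D ^ r * (1 + (\<Sum>i\<in>UNIV. norm (z $ i) powr (real r * p)))" for z
  proof (cases "b \<le> norm z")
    case False
    then have "\<bar>u z\<bar> \<le> D" using B[of z] D by auto
    then have "\<bar>u z\<bar> ^ r \<le> D ^ r * 1" by (simp add: power_mono)
    also have "\<dots> \<le> D ^ r * (1 + (\<Sum>i\<in>UNIV. norm (z $ i) powr (real r * p)))"
      using D by (intro mult_left_mono) (auto intro!: sum_nonneg)
    finally show ?thesis .
  next
    case True
    have "(MAX i. norm (z $ i) powr p) \<in> range (\<lambda>i. norm (z $ i) powr p)"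
      by (rule Max_in) auto
    then obtain i where i: "(MAX i. norm (z $ i) powr p) = norm (z $ i) powr p"
      unfolding image_iff by blast
    have "\<bar>u z\<bar> \<le> c * norm (z $ i) powr p" using b[OF True] unfolding i by simp
    also have "\<dots> \<le> D * norm (z $ i) powr p" using D by (intro mult_right_mono) auto
    finally have "\<bar>u z\<bar> ^ r \<le> D ^ r * (norm (z $ i) powr p) ^ r"
      by (metis power_mono abs_ge_zero power_mult_distrib)
    \<comment> \<open>For \<open>z $ i = 0\<close> both sides are 0, as \<open>0 powr _ = 0\<close>
      even for exponent 0, and \<open>0 < r\<close> rules out \<open>0 ^ 0\<close>.\<close>
    also have "(norm (z $ i) powr p) ^ r = norm (z $ i) powr (real r * p)"
      using r by (cases "z $ i = 0") (auto simp: powr_power)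
    also have "\<dots> \<le> (\<Sum>i\<in>UNIV. norm (z $ i) powr (real r * p))"
      by (rule member_le_sum) auto
    also have "\<dots> \<le> 1 + (\<Sum>i\<in>UNIV. norm (z $ i) powr (real r * p))" by simp
    finally show ?thesis using D by (simp add: mult_left_mono)
  qed
  then show ?thesis by blast
qed

section \<open>Reduction to an i.i.d. sequence\<close>

text \<open>The copies are numbered from 1, the limit theorems from 0. Injectivity of
  \<open>f\<close> lets a finite family of events over \<open>J\<close> be carried to the image of
  \<open>J\<close> without changing the product.\<close>

lemma (in prob_space) indep_sets_reindex:
  assumes indep: "indep_sets F (f ` I)" and inj: "inj_on f I"
  shows "indep_sets (\<lambda>i. F (f i)) I"
proof (rule indep_setsI)
  show "F (f i) \<subseteq> events" if "i \<in> I" for i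
    using indep that unfolding indep_sets_def by auto
  fix A J assume J: "J \<noteq> {}" "J \<subseteq> I" "finite J" and A: "\<forall>j\<in>J. A j \<in> F (f j)"
  have injJ: "inj_on f J" using inj J(2) by (rule inj_on_subset)
  define B where "B k = A (the_inv_into J f k)" for k
  have B: "B (f j) = A j" if "j \<in> J" for j
    using the_inv_into_f_f[OF injJ that] by (simp add: B_def)
  have "prob (\<Inter>k\<in>f ` J. B k) = (\<Prod>k\<in>f ` J. prob (B k))"
    by (rule indep_setsD[OF indep]) (use J A B in auto)
  then show "prob (\<Inter>j\<in>J. A j) = (\<Prod>j\<in>J. prob (A j))"
    by (simp add: prod.reindex[OF injJ] B cong: prod.cong)
qed

lemma (in prob_space) indep_vars_reindex:
  assumes "indep_vars N X (f ` I)" "inj_on f I"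
  shows "indep_vars (\<lambda>i. N (f i)) (\<lambda>i. X (f i)) I"
  using assms indep_sets_reindex[OF _ assms(2), of "\<lambda>i. {X i -` A \<inter> space M |A. A \<in> sets (N i)}"]
  unfolding indep_vars_def2 by auto

text \<open>By \<open>|X - c| \<le> 2 * max |X| |c|\<close>.\<close>

lemma integrable_power_diff_const:
  fixes X :: "'a \<Rightarrow> real"
  assumes "prob_space m" and [measurable]: "X \<in> borel_measurable m"
    and int: "integrable m (\<lambda>x. \<bar>X x\<bar> ^ r)"
  shows "integrable m (\<lambda>x. \<bar>X x - c\<bar> ^ r)"
proof -
  interpret prob_space m by fact
  have *: "\<bar>X x - c\<bar> ^ r \<le> 2 ^ r * (\<bar>X x\<bar> ^ r + \<bar>c\<bar> ^ r)" for x
  proof -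
    have "\<bar>X x - c\<bar> ^ r \<le> (2 * max \<bar>X x\<bar> \<bar>c\<bar>) ^ r"
      by (rule power_mono) auto
    also have "\<dots> = 2 ^ r * max \<bar>X x\<bar> \<bar>c\<bar> ^ r" by (simp add: power_mult_distrib)
    also have "\<dots> \<le> 2 ^ r * (\<bar>X x\<bar> ^ r + \<bar>c\<bar> ^ r)" by (intro mult_left_mono) (auto simp: max_def)
    finally show ?thesis .
  qed
  have "integrable m (\<lambda>x. 2 ^ r * (\<bar>X x\<bar> ^ r + \<bar>c\<bar> ^ r))"
    using int by auto
  then show ?thesis
    by (rule Bochner_Integration.integrable_bound) (use * in \<open>auto intro: order_trans[OF _ abs_ge_self]\<close>)
qed

text \<open>Formulated for abstract paths, so that equality of laws on the product of the path
  spaces can be used. \<open>eval_at\<close> makes it measurable there, and \<open>max 0\<close> is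
  for abstract time paths with negative values.\<close>

definition sample_path ::
    "('n::finite \<Rightarrow> real) \<Rightarrow> (real \<Rightarrow> 'a::euclidean_space) \<times> (real \<Rightarrow> real) \<Rightarrow> 'a ^ 'n" where
  "sample_path t p = (\<chi> i. eval_at (fst p) (max 0 (snd p (t i))))"

lemma measurable_sample_path:
  fixes t :: "'n::finite \<Rightarrow> real"
  assumes "\<And>i. 0 \<le> t i"
  shows "(sample_path t :: _ \<Rightarrow> 'a::euclidean_space ^ 'n) \<in> borel_measurable (path_space \<Otimes>\<^sub>M path_space)"
proof (subst borel_measurable_euclidean_space, intro ballI)
  fix e :: "'a ^ 'n" assume "e \<in> Basis"
  then obtain i b where e: "e = axis i b" by (auto simp: Basis_vec_def)
  have [measurable]: "(\<lambda>p :: (real \<Rightarrow> 'a) \<times> (real \<Rightarrow> real). eval_at (fst p) (max 0 (snd p (t i))))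
      \<in> borel_measurable (path_space \<Otimes>\<^sub>M path_space)"
    using measurable_compose[OF measurable_snd measurable_path_component[OF assms]]
    by (intro measurable_eval_at[where X = "\<lambda>s p. fst p s"])
       (auto intro!: measurable_compose[OF measurable_fst measurable_path_component] borel_measurable_max)
  show "(\<lambda>p. sample_path t p \<bullet> e) \<in> borel_measurable (path_space \<Otimes>\<^sub>M path_space)"
    unfolding sample_path_def e inner_axis by simp
qed

lemma sample_path_trajectories:
  assumes "cadlag (\<lambda>s. X s \<omega>)" "\<And>i. 0 \<le> t i" "\<And>s. 0 \<le> s \<Longrightarrow> 0 \<le> T s \<omega>"
  shows "sample_path t (trajectory X \<omega>, trajectory T \<omega>) = sampled X T t \<omega>"
  using assms by (simp add: sample_path_def sampled_def eval_at_trajectory trajectory_eq vec_eq_iff)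

section \<open>The standardised error as a normalised i.i.d. sum, and the two conclusions\<close>

theorem theorem4p2:
  fixes P :: "real ^ 'd \<Rightarrow> 'w measure"
    and M :: "real \<Rightarrow> 'w \<Rightarrow> real ^ 'd"
    and \<sigma> T :: "real \<Rightarrow> 'w \<Rightarrow> real"
    and b :: real and \<nu> :: "real measure"
    and t :: "'n::{finite, linorder} \<Rightarrow> real"
    and u :: "(real ^ 'd, 'n) vec \<Rightarrow> real"
    and p :: real
    and x :: "real ^ 'd"
    and Q :: "'v measure"
    and M' :: "nat \<Rightarrow> real \<Rightarrow> 'v \<Rightarrow> real ^ 'd"
    and T' :: "nat \<Rightarrow> real \<Rightarrow> 'v \<Rightarrow> real"
    and S :: "nat \<Rightarrow> 'v \<Rightarrow> real"
  assumes feller: "feller_process P M"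
    and subordinator: "\<And>y. strict_subordinator (P y) b \<nu> \<sigma>"
    and independent: "\<And>y. indep_processes (P y) M \<sigma>"
    and T: "T \<in> {inverse_process \<sigma>, undershooting \<sigma>, overshooting \<sigma>}"
    and t_nonneg: "\<And>i. 0 \<le> t i"
    and t_mono: "strict_mono t"
    and u_measurable: "u \<in> borel_measurable borel"
    and u_bounded: "locally_bounded u"
    and p_nonneg: "0 \<le> p"
    and u_growth: "u \<in> O[at_infinity](\<lambda>z. MAX i. norm (z $ i) powr p)"
    and copies: "iid_copies Q M' T' (P x) M T"
    and sd_nonzero: "q_sd (P x) M T u t \<noteq> 0"
    and S: "\<And>N \<omega>. S N \<omega> =
              sqrt (real N) * (q_emp M' T' u t N \<omega> - q_mean (P x) M T u t) / q_sd (P x) M T u t"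
  shows "((p > 0 \<longrightarrow> (\<forall>i. tail_condition (P x) M T (2 * p) (t i))) \<longrightarrow>
            (\<forall>\<psi>\<in>bcontfun. (\<lambda>N. \<integral>\<omega>. \<psi> (S N \<omega>) \<partial>Q) \<longlonglongrightarrow> gauss_integral \<psi>)) \<and>
         ((p > 0 \<longrightarrow> (\<forall>i. tail_condition (P x) M T (3 * p) (t i))) \<longrightarrow>
            (\<forall>\<psi>\<in>Cb3. \<forall>N\<ge>1.
               \<bar>(\<integral>\<omega>. \<psi> (S N \<omega>) \<partial>Q) - gauss_integral \<psi>\<bar>
                 \<le> 1 / 6 * (1 + 2 * sqrt (2 / pi)) * (SUP w. \<bar>(deriv ^^ 3) \<psi> w\<bar>) *
                    (q_rho (P x) M T u t / (sqrt (real N) * q_sd (P x) M T u t ^ 3))))"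
proof -
  let ?R = "P x"
  interpret R: prob_space "P x" using feller by (auto simp: feller_process_def)
  interpret Q: prob_space Q using copies by (auto simp: iid_copies_def)
  have M_meas: "M s \<in> borel_measurable ?R" if "0 \<le> s" for s
    using feller that by (auto simp: feller_process_def)
  have M_cadlag: "cadlag (\<lambda>s. M s \<omega>)" if "\<omega> \<in> space ?R" for \<omega>
    using feller that by (auto simp: feller_process_def)
  have \<sigma>: "\<sigma> s \<in> borel_measurable ?R" if "0 \<le> s" for s
    using subordinator[of x] that by (auto simp: strict_subordinator_def)
  \<comment> \<open>Events of \<open>T\<close> lie in \<open>?A\<close>, generated by
    \<open>\<sigma>\<close>, so the independence of \<open>M\<close> and \<open>\<sigma>\<close>
    extends to \<open>T\<close>.\<close>
  let ?A = "vimage_algebra (space ?R) (trajectory \<sigma>) path_space"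
  have \<sigma>A: "\<sigma> s \<in> borel_measurable ?A" if "0 \<le> s" for s
  proof -
    have "(\<lambda>\<omega>. trajectory \<sigma> \<omega> s) \<in> borel_measurable ?A"
      by (rule measurable_compose[OF measurable_vimage_algebra1 measurable_path_component[OF that]])
         (auto intro: trajectory_in_path_space)
    then show ?thesis using that by (simp add: trajectory_eq)
  qed
  note \<sigma>_path = subordinator[of x, unfolded strict_subordinator_def]
  have TA: "T s \<in> borel_measurable ?A" for s
    using \<sigma>_path by (intro time_change_measurable_nonneg(1)[OF T \<sigma>A]) auto
  have T_nonneg: "0 \<le> T s \<omega>" if "\<omega> \<in> space ?R" for s \<omega>
    using \<sigma>_path that by (intro time_change_measurable_nonneg(2)[OF T \<sigma>]) auto
  have TR: "T s \<in> borel_measurable ?R" for s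
    by (rule R.distr_pair_indep_processes(1)[OF independent M_meas \<sigma> TA])
  let ?q = "q_mean ?R M T u t" and ?s = "q_sd ?R M T u t"
  define Y where "Y \<omega> = u (sampled M T t \<omega>)" for \<omega>
  \<comment> \<open>Standardisation as one measurable function of the two trajectories: applied to
    the independent copies it yields an i.i.d. sequence whose law is that of the standardised
    \<open>Y\<close>.\<close>
  define G where "G p = (u (sample_path t p) - ?q) / ?s" for p
  have G[measurable]: "G \<in> borel_measurable (path_space \<Otimes>\<^sub>M path_space)"
    unfolding G_def
    using measurable_compose[OF measurable_sample_path[of t, OF t_nonneg] u_measurable] by measurable
  have pair0[measurable]: "(\<lambda>\<omega>. (trajectory M \<omega>, trajectory T \<omega>)) \<in> measurable ?R (path_space \<Otimes>\<^sub>M path_space)"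
    using M_meas TR by (intro measurable_Pair measurable_trajectory)
  have Y_eq: "u (sample_path t (trajectory M \<omega>, trajectory T \<omega>)) = Y \<omega>" if "\<omega> \<in> space ?R" for \<omega>
    unfolding Y_def using that
    by (subst sample_path_trajectories) (auto intro: M_cadlag T_nonneg t_nonneg)
  have Y[measurable]: "Y \<in> borel_measurable ?R"
    using measurable_compose[OF pair0 measurable_compose[OF measurable_sample_path[of t, OF t_nonneg] u_measurable]]
    by (subst measurable_cong[OF Y_eq[symmetric]])
  define law where "law = distr ?R borel (\<lambda>\<omega>. (Y \<omega> - ?q) / ?s)"
  let ?pair = "\<lambda>k \<omega>. (trajectory (M' k) \<omega>, trajectory (T' k) \<omega>)"
  define X where "X k \<omega> = G (?pair (Suc k) \<omega>)" for k \<omega>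
  have "Q.indep_vars (\<lambda>_. path_space \<Otimes>\<^sub>M path_space) ?pair {1..}"
    using copies by (auto simp: iid_copies_def)
  moreover have "{1..} = range Suc"
    by (auto simp: image_iff Suc_le_D)
  ultimately have pairs: "Q.indep_vars (\<lambda>_. path_space \<Otimes>\<^sub>M path_space) (\<lambda>k. ?pair (Suc k)) UNIV"
    using Q.indep_vars_reindex[of "\<lambda>_. path_space \<Otimes>\<^sub>M path_space" ?pair Suc UNIV] by simp
  then have X_indep: "Q.indep_vars (\<lambda>_. borel) X UNIV"
    unfolding X_def by (rule Q.indep_vars_compose2) simp
  have X_law: "distr Q borel (X k) = law" for k
  proof -
    have [measurable]: "?pair (Suc k) \<in> measurable Q (path_space \<Otimes>\<^sub>M path_space)"
      using pairs unfolding Q.indep_vars_def2 by simp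
    have "distr Q borel (X k) = distr (distr Q (path_space \<Otimes>\<^sub>M path_space) (?pair (Suc k))) borel G"
      by (subst distr_distr) (auto simp: X_def[abs_def] comp_def)
    also have "\<dots> = distr (distr ?R (path_space \<Otimes>\<^sub>M path_space) (\<lambda>\<omega>. (trajectory M \<omega>, trajectory T \<omega>))) borel G"
      using copies by (simp add: iid_copies_def)
    also have "\<dots> = law"
      unfolding law_def by (subst distr_distr) (auto simp: G_def Y_eq intro!: distr_cong)
    finally show ?thesis .
  qed
  have S_eq: "S N \<omega> = (\<Sum>k<N. X k \<omega>) / sqrt (real N)" if "\<omega> \<in> space Q" "1 \<le> N" for N \<omega>
  proof -
    have X: "X k \<omega> = (u (sampled (M' (Suc k)) (T' (Suc k)) t \<omega>) - ?q) / ?s" for k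
      unfolding X_def G_def using that(1) copies
      by (subst sample_path_trajectories) (auto simp: iid_copies_def intro: t_nonneg)
    define A where "A = (\<Sum>k<N. u (sampled (M' (Suc k)) (T' (Suc k)) t \<omega>))"
    have "(\<Sum>k<N. X k \<omega>) = (A - real N * ?q) / ?s"
      unfolding X A_def by (simp add: sum_subtractf flip: sum_divide_distrib)
    moreover have "S N \<omega> = sqrt (real N) * (A / real N - ?q) / ?s"
      by (simp add: S q_emp_def A_def sum.atLeast1_atMost_eq)
    moreover have "sqrt (real N) * (A / real N - ?q) = (A - real N * ?q) / sqrt (real N)"
    proof -
      have "sqrt (real N) * (A / real N - ?q) = (A - real N * ?q) * (sqrt (real N) / real N)"
        using that(2) by (simp add: field_simps)
      also have "sqrt (real N) / real N = 1 / sqrt (real N)"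
        using that(2) by (simp add: sqrt_divide_self_eq inverse_eq_divide)
      finally show ?thesis by simp
    qed
    ultimately show ?thesis by (simp add: mult.commute)
  qed
  have moment: "integrable ?R (\<lambda>\<omega>. \<bar>Y \<omega>\<bar> ^ r)"
    if tail: "p > 0 \<longrightarrow> (\<forall>i. tail_condition ?R M T (real r * p) (t i))" and r: "0 < r" for r
  proof -
    obtain C where C: "\<And>z. \<bar>u z\<bar> ^ r \<le> C * (1 + (\<Sum>i\<in>UNIV. norm (z $ i) powr (real r * p)))"
      using polynomial_growth_power_bound[OF u_bounded p_nonneg r u_growth] by blast
    have int: "integrable ?R (\<lambda>\<omega>. norm (M (T (t i) \<omega>) \<omega>) powr (real r * p))" for i
    proof (cases "p > 0")
      case True
      show ?thesis
        by (rule R.integrable_moment_indep_time[OF independent M_meas \<sigma> M_cadlag])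
           (use True tail r in \<open>auto intro: TA T_nonneg\<close>)
    next
      case False
      have [measurable]: "(\<lambda>\<omega>. M (T (t i) \<omega>) \<omega>) \<in> borel_measurable ?R"
        by (rule measurable_cadlag_at[OF M_meas M_cadlag TR T_nonneg])
      \<comment> \<open>Here \<open>p = 0\<close>, so the power takes only the values 0 and
        1.\<close>
      show ?thesis
        by (rule R.integrable_const_bound[where B = 1]) (use False p_nonneg in \<open>auto simp: powr_def\<close>)
    qed
    have "integrable ?R (\<lambda>\<omega>. C * (1 + (\<Sum>i\<in>UNIV. norm (sampled M T t \<omega> $ i) powr (real r * p))))"
      unfolding sampled_def using int by auto
    moreover have "\<bar>Y \<omega>\<bar> ^ r \<le> C * (1 + (\<Sum>i\<in>UNIV. norm (sampled M T t \<omega> $ i) powr (real r * p)))" for \<omega>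
      unfolding Y_def by (rule C)
    ultimately show ?thesis
      by (elim Bochner_Integration.integrable_bound) (auto intro: order_trans[OF _ abs_ge_self])
  qed
  have s_pos: "0 < ?s"
    using sd_nonzero by (simp add: q_sd_def less_le)
  have s_sq: "?s\<^sup>2 = (\<integral>\<omega>. (Y \<omega> - ?q)\<^sup>2 \<partial>?R)"
    by (simp add: q_sd_def Y_def)
  have q_eq: "?q = (\<integral>\<omega>. Y \<omega> \<partial>?R)"
    by (simp add: q_mean_def Y_def)
  have mean: "(\<integral>w. w \<partial>law) = 0" if "integrable ?R Y"
    unfolding law_def using that by (subst integral_distr) (auto simp: R.prob_space q_eq)
  have var: "(\<integral>w. w\<^sup>2 \<partial>law) = 1"
    unfolding law_def using s_pos
    by (subst integral_distr) (auto simp: power_divide simp flip: s_sq)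
  have clt: "(\<lambda>N. \<integral>\<omega>. \<psi> (S N \<omega>) \<partial>Q) \<longlonglongrightarrow> gauss_integral \<psi>"
    if tail: "p > 0 \<longrightarrow> (\<forall>i. tail_condition ?R M T (2 * p) (t i))" and \<psi>: "\<psi> \<in> bcontfun" for \<psi>
  proof -
    have int2: "integrable ?R (\<lambda>\<omega>. \<bar>Y \<omega>\<bar> ^ 2)" using moment[of 2] tail by simp
    have "integrable law (\<lambda>w. w\<^sup>2)"
      unfolding law_def using integrable_power_diff_const[OF R.prob_space_axioms Y int2, of ?q]
      by (subst integrable_distr_eq) (auto simp: power_divide)
    moreover have "integrable ?R Y"
      using R.square_integrable_imp_integrable[OF Y] int2 by simp
    moreover obtain B where B: "\<And>w. \<bar>\<psi> w\<bar> \<le> B" and cont: "continuous_on UNIV \<psi>"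
      using \<psi> by (auto simp: bcontfun_def bounded_iff)
    ultimately have "(\<lambda>N. \<integral>\<omega>. \<psi> ((\<Sum>k<N. X k \<omega>) / sqrt (real N)) \<partial>Q) \<longlonglongrightarrow> (\<integral>w. \<psi> w \<partial>std_normal_distribution)"
      using mean var by (intro Q.central_limit_bounded_continuous[OF X_indep X_law]) auto
    moreover have "\<forall>\<^sub>F N in sequentially. (\<integral>\<omega>. \<psi> ((\<Sum>k<N. X k \<omega>) / sqrt (real N)) \<partial>Q) = (\<integral>\<omega>. \<psi> (S N \<omega>) \<partial>Q)"
      using eventually_ge_at_top[of 1]
      by eventually_elim (auto simp: S_eq intro!: Bochner_Integration.integral_cong)
    moreover have "gauss_integral \<psi> = (\<integral>w. \<psi> w \<partial>std_normal_distribution)"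
      by (rule gauss_integral_eq[OF borel_measurable_continuous_onI[OF cont]])
    ultimately show ?thesis by (simp add: tendsto_cong)
  qed
  have rate: "\<bar>(\<integral>\<omega>. \<psi> (S N \<omega>) \<partial>Q) - gauss_integral \<psi>\<bar>
      \<le> 1 / 6 * (1 + 2 * sqrt (2 / pi)) * (SUP w. \<bar>(deriv ^^ 3) \<psi> w\<bar>) *
         (q_rho ?R M T u t / (sqrt (real N) * ?s ^ 3))"
    if tail: "p > 0 \<longrightarrow> (\<forall>i. tail_condition ?R M T (3 * p) (t i))"
      and \<psi>: "\<psi> \<in> Cb3" and N: "1 \<le> N" for \<psi> N
  proof -
    have int3: "integrable ?R (\<lambda>\<omega>. \<bar>Y \<omega>\<bar> ^ 3)" using moment[of 3] tail by simp
    note intY = integrable_lower_moments(1)[OF R.prob_space_axioms Y int3]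
    have law3: "integrable law (\<lambda>w. \<bar>w\<bar> ^ 3)"
      unfolding law_def using integrable_power_diff_const[OF R.prob_space_axioms Y int3, of ?q]
      by (subst integrable_distr_eq) (auto simp: power_divide abs_divide)
    let ?\<beta> = "\<integral>w. \<bar>w\<bar> ^ 3 \<partial>law" and ?K = "SUP w. \<bar>(deriv ^^ 3) \<psi> w\<bar>"
    have \<beta>: "?\<beta> = q_rho ?R M T u t / ?s ^ 3"
    proof -
      have "q_rho ?R M T u t = (\<integral>\<omega>. \<bar>Y \<omega> - ?q\<bar> ^ 3 \<partial>?R)"
        by (simp add: q_rho_def Y_def)
      then show ?thesis
        unfolding law_def using s_pos
        by (subst integral_distr) (auto simp: power_divide abs_divide)
    qed
    interpret law: prob_space law unfolding law_def by (rule R.prob_space_distr) measurable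
    have \<beta>1: "1 \<le> ?\<beta>"
      by (rule law.second_moment_le_third_moment) (use var law3 in \<open>auto simp: law_def\<close>)
    have bc: "(deriv ^^ k) \<psi> \<in> bcontfun" if "k \<le> 3" for k
      using \<psi> that unfolding Cb3_def by blast
    have diff: "(deriv ^^ k) \<psi> differentiable at w" if "k < 3" for k w
      using \<psi> that unfolding Cb3_def by blast
    \<comment> \<open>Boundedness of the third derivative is what makes the real-valued supremum an
      upper bound of its values.\<close>
    have "bdd_above (range (\<lambda>w. \<bar>(deriv ^^ 3) \<psi> w\<bar>))"
      using bc[of 3] by (auto simp: bcontfun_def bounded_iff bdd_above_def)
    then have K: "\<bar>(deriv ^^ 3) \<psi> w\<bar> \<le> ?K" for w by (rule cSUP_upper[OF UNIV_I])
    then have K0: "0 \<le> ?K" using abs_ge_zero order_trans by blast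
    obtain B where B: "\<And>w. \<bar>\<psi> w\<bar> \<le> B" and cont: "continuous_on UNIV \<psi>"
      using bc[of 0] by (auto simp: bcontfun_def bounded_iff)
    have "\<bar>(\<integral>\<omega>. \<psi> (S N \<omega>) \<partial>Q) - gauss_integral \<psi>\<bar>
      = \<bar>(\<integral>\<omega>. \<psi> ((\<Sum>k<N. X k \<omega>) / sqrt (real N)) \<partial>Q) - (\<integral>w. \<psi> w \<partial>std_normal_distribution)\<bar>"
      using N gauss_integral_eq[OF borel_measurable_continuous_onI[OF cont]]
      by (simp add: S_eq cong: Bochner_Integration.integral_cong)
    also have "\<dots> \<le> ?K / 6 * (?\<beta> + 2 * sqrt (2 / pi)) / sqrt (real N)"
      by (rule Q.normal_approximation_third_moment[OF X_indep X_law mean[OF intY] var law3 diff K B N])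
    \<comment> \<open>Since \<open>1 \<le> ?\<beta>\<close>, the Gaussian third moment may be
      multiplied by \<open>?\<beta>\<close>; factoring out \<open>?\<beta>\<close> gives the stated
      constant.\<close>
    also have "\<dots> \<le> ?K / 6 * (?\<beta> + 2 * sqrt (2 / pi) * ?\<beta>) / sqrt (real N)"
      using \<beta>1 K0 by (intro divide_right_mono mult_left_mono add_left_mono) auto
    also have "\<dots> = 1 / 6 * (1 + 2 * sqrt (2 / pi)) * ?K * (?\<beta> / sqrt (real N))"
    proof -
      have "?K / 6 * (?\<beta> + 2 * sqrt (2 / pi) * ?\<beta>) = 1 / 6 * (1 + 2 * sqrt (2 / pi)) * ?K * ?\<beta>"
        by (simp add: algebra_simps)
      then show ?thesis by (simp only: times_divide_eq_right)
    qed
    also have "?\<beta> / sqrt (real N) = q_rho ?R M T u t / (sqrt (real N) * ?s ^ 3)"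
      unfolding \<beta> by (simp add: mult.commute)
    finally show ?thesis .
  qed
  show ?thesis using clt rate by blast
qed

end
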